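(* For each of the ten families of inequalities (C1)–(C5), (D1)–(D5) listed in the context, there is a polynomial-time algorithm which, given $J,S_1,S_2,l,u$ and a rational point $(\hat\delta,\hat z)\in\mathbb{Q}^4\times\mathbb{Q}^J$ satisfying all inequalities (A) and (B) of the context, finds a most violated inequality of that family at $(\hat\delta,\hat z)$, i.e. an admissible choice of $Q\subseteq J$ (and of $i$, or $(i,k)$, where applicable) maximizing the left-hand side minus the right-hand side of the inequality evaluated at $(\hat\delta,\hat z)$ over all admissible choices. In particular, the separation problem for inequalities (C1)–(C5), (D1)–(D5) can be solved in polynomial time.
   Context: Setting: $J$ is a finite set with $|J|=n$; $l,u$ are integers with $l\ge 0$, $u\ge 2$, $u\ge l+1$; $S_1,S_2\subseteq J$ satisfy $2\le|S_i|\le n-l$ for $i\in\{1,2\}$, $S_1\setminus S_2\ne\emptyset$ and $S_2\setminus S_1\neq\emptyset$. Put $S_0:=S_1\cap S_2$ and $S_3:=S_1\cup S_2$. Variables are $\delta=(\delta_0,\delta_1,\delta_2,\delta_3)\in\mathbb{R}^4$ and $z\in\mathbb{R}^J$. (A) $\delta_0\le 1$; $-\delta_3\le 0$; $\delta_3\le\delta_i$ for $i\in\{1,2\}$; $\delta_1+\delta_2\le\delta_0+\delta_3$. (B) $\sum_{j\in J}z_j\le u$; $z_j+\delta_i\le 1$ for $j\in S_i$, $i\in\{0,1,2\}$; $z_j\le 1$ for $j\in J$; $1-\delta_0-\sum_{j\in S_0}z_j\le 0$; $\delta_0-\delta_i-\sum_{j\in S_i\setminus S_0}z_j\le 0$ for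 $i\in\{1,2\}$; $-z_j\le 0$ for $j\in J$; $-\sum_{j\in J}z_j\le -l$. Families indexed by $Q\subseteq J$ (a choice is admissible if it satisfies the stated condition): (C1) $\sum_{j\in Q}z_j+(u-|Q\setminus S_0|)\delta_0+\sum_{i=1}^2|(Q\cap S_i)\setminus S_0|\,\delta_i\le u$, if $|Q\setminus S_0|\le u$; (C2) $\sum_{j\in Q}z_j+\sum_{i=1}^2(u-|Q\setminus S_i|)\delta_i+(|Q\setminus S_0|-u)\delta_3\le u$; (C3) $\sum_{j\in Q}z_j+\delta_0-\delta_i+(u-1-|Q\setminus S_k|)\delta_k+\delta_3\le u$, if $\{i,k\}=\{1,2\}$ and $Q\cap(S_i\setminus S_0)=\emptyset$; (C4) $\sum_{j\in Q}z_j+(u-|Q\setminus S_i|)\delta_i+|(Q\cap S_3)\setminus S_i|\,\delta_3\le u$, if $i\in\{1,2\}$ and $|Q\setminus S_i|\le u$; (C5) $\sum_{j\in Q}z_j+(u-|Q\setminus S_3|)\delta_3\le u$, if $|Q\setminus S_3|\le u$; (D1) $-\sum_{j\in Q}z_j+(l+|Q\cup S_0|-n)\delta_0+\sum_{i=1}^2|S_i\setminus (S_0\cup Q)|\,\delta_i\le 0$, if $|Q\cup S_0|\ge n-l$; (D2) $-\sum_{j\in Q}z_j+\sum_{i=1}^2(l+|Q\cup S_i|-n)\delta_i+(n-|Q\cup S_0|-l)\delta_3\le 0$; (D3) $-\sum_{j\in Q}z_j+\delta_0-\delta_i+(l+|Q\cup S_k|-1-n)\delta_k+\delta_3\le 0$,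 if $\{i,k\}=\{1,2\}$ and $S_i\setminus S_0\subseteq Q$; (D4) $-\sum_{j\in Q}z_j+(l+|Q\cup S_i|-n)\delta_i+|S_3\setminus (S_i\cup Q)|\,\delta_3\le 0$, if $i\in\{1,2\}$ and $|Q\cup S_i|\ge n-l$; (D5) $-\sum_{j\in Q}z_j+(l+|Q\cup S_3|-n)\delta_3\le 0$, if $|Q\cup S_3|\ge n-l$. The separation problem: given a point, decide whether it satisfies all inequalities of the families, and if not, output a violated one. *)

theory Defs
  imports
    Complex_Main
    "HOL-Library.Log_Nat"
    "HOL-Computational_Algebra.Polynomial"
begin

section \<open>The inequalities\<close>

text \<open>
  One constructor per family; its arguments are the choices that index the family. In
  \<open>C3 i k Q\<close> and \<open>D3 i k Q\<close> the pair \<open>(i, k)\<close> ranges over the two orderings of \<open>{1, 2}\<close>.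
\<close>

datatype 'a ineq =
    C1 "'a set" | C2 "'a set" | C3 nat nat "'a set" | C4 nat "'a set" | C5 "'a set"
  | D1 "'a set" | D2 "'a set" | D3 nat nat "'a set" | D4 nat "'a set" | D5 "'a set"

fun family :: "'a ineq \<Rightarrow> nat" where
  "family (C1 Q) = 1"
| "family (C2 Q) = 2"
| "family (C3 i k Q) = 3"
| "family (C4 i Q) = 4"
| "family (C5 Q) = 5"
| "family (D1 Q) = 6"
| "family (D2 Q) = 7"
| "family (D3 i k Q) = 8"
| "family (D4 i Q) = 9"
| "family (D5 Q) = 10"

locale setting =
  fixes J S1 S2 :: "'a set" and l u :: int
  assumes finite_J: "finite J"
    and l_nonneg: "0 \<le> l" and u_ge_2: "2 \<le> u" and l_less_u: "l + 1 \<le> u"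
    and S1_subset: "S1 \<subseteq> J" and S2_subset: "S2 \<subseteq> J"
    and card_S1: "2 \<le> int (card S1)" "int (card S1) \<le> int (card J) - l"
    and card_S2: "2 \<le> int (card S2)" "int (card S2) \<le> int (card J) - l"
    and S1_diff: "S1 - S2 \<noteq> {}" and S2_diff: "S2 - S1 \<noteq> {}"
begin

definition n :: int where "n = int (card J)"

definition S :: "nat \<Rightarrow> 'a set" where
  "S i = (if i = 0 then S1 \<inter> S2 else if i = 1 then S1 else if i = 2 then S2 else S1 \<union> S2)"

text \<open>A vector \<open>(\<delta>\<^sub>0, \<delta>\<^sub>1, \<delta>\<^sub>2, \<delta>\<^sub>3)\<close> is a function on \<open>nat\<close> of which only the values at
  0, 1, 2, 3 are used; likewise only the values of \<open>z\<close> on \<open>J\<close> are used.\<close>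

definition satisfies_A :: "(nat \<Rightarrow> 'b::linordered_field) \<Rightarrow> bool" where
  "satisfies_A \<delta> \<longleftrightarrow>
     \<delta> 0 \<le> 1 \<and> - \<delta> 3 \<le> 0 \<and> (\<forall>i\<in>{1, 2}. \<delta> 3 \<le> \<delta> i) \<and> \<delta> 1 + \<delta> 2 \<le> \<delta> 0 + \<delta> 3"

definition satisfies_B :: "(nat \<Rightarrow> 'b::linordered_field) \<Rightarrow> ('a \<Rightarrow> 'b) \<Rightarrow> bool" where
  "satisfies_B \<delta> z \<longleftrightarrow>
     (\<Sum>j\<in>J. z j) \<le> of_int u \<and>
     (\<forall>i\<in>{0, 1, 2}. \<forall>j\<in>S i. z j + \<delta> i \<le> 1) \<and>
     (\<forall>j\<in>J. z j \<le> 1) \<and>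
     1 - \<delta> 0 - (\<Sum>j\<in>S 0. z j) \<le> 0 \<and>
     (\<forall>i\<in>{1, 2}. \<delta> 0 - \<delta> i - (\<Sum>j\<in>S i - S 0. z j) \<le> 0) \<and>
     (\<forall>j\<in>J. - z j \<le> 0) \<and>
     - (\<Sum>j\<in>J. z j) \<le> - of_int l"

fun admissible :: "'a ineq \<Rightarrow> bool" where
  "admissible (C1 Q) \<longleftrightarrow> Q \<subseteq> J \<and> int (card (Q - S 0)) \<le> u"
| "admissible (C2 Q) \<longleftrightarrow> Q \<subseteq> J"
| "admissible (C3 i k Q) \<longleftrightarrow> Q \<subseteq> J \<and> {i, k} = {1, 2} \<and> Q \<inter> (S i - S 0) = {}"
| "admissible (C4 i Q) \<longleftrightarrow> Q \<subseteq> J \<and> i \<in> {1, 2} \<and> int (card (Q - S i)) \<le> u"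
| "admissible (C5 Q) \<longleftrightarrow> Q \<subseteq> J \<and> int (card (Q - S 3)) \<le> u"
| "admissible (D1 Q) \<longleftrightarrow> Q \<subseteq> J \<and> int (card (Q \<union> S 0)) \<ge> n - l"
| "admissible (D2 Q) \<longleftrightarrow> Q \<subseteq> J"
| "admissible (D3 i k Q) \<longleftrightarrow> Q \<subseteq> J \<and> {i, k} = {1, 2} \<and> S i - S 0 \<subseteq> Q"
| "admissible (D4 i Q) \<longleftrightarrow> Q \<subseteq> J \<and> i \<in> {1, 2} \<and> int (card (Q \<union> S i)) \<ge> n - l"
| "admissible (D5 Q) \<longleftrightarrow> Q \<subseteq> J \<and> int (card (Q \<union> S 3)) \<ge> n - l"

fun lhs :: "(nat \<Rightarrow> 'b::linordered_field) \<Rightarrow> ('a \<Rightarrow> 'b) \<Rightarrow> 'a ineq \<Rightarrow> 'b" where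
  "lhs \<delta> z (C1 Q) =
     (\<Sum>j\<in>Q. z j) + of_int (u - int (card (Q - S 0))) * \<delta> 0
       + (\<Sum>i\<in>{1, 2}. of_nat (card ((Q \<inter> S i) - S 0)) * \<delta> i)"
| "lhs \<delta> z (C2 Q) =
     (\<Sum>j\<in>Q. z j) + (\<Sum>i\<in>{1, 2}. of_int (u - int (card (Q - S i))) * \<delta> i)
       + of_int (int (card (Q - S 0)) - u) * \<delta> 3"
| "lhs \<delta> z (C3 i k Q) =
     (\<Sum>j\<in>Q. z j) + \<delta> 0 - \<delta> i + of_int (u - 1 - int (card (Q - S k))) * \<delta> k + \<delta> 3"
| "lhs \<delta> z (C4 i Q) =
     (\<Sum>j\<in>Q. z j) + of_int (u - int (card (Q - S i))) * \<delta> i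
       + of_nat (card ((Q \<inter> S 3) - S i)) * \<delta> 3"
| "lhs \<delta> z (C5 Q) =
     (\<Sum>j\<in>Q. z j) + of_int (u - int (card (Q - S 3))) * \<delta> 3"
| "lhs \<delta> z (D1 Q) =
     - (\<Sum>j\<in>Q. z j) + of_int (l + int (card (Q \<union> S 0)) - n) * \<delta> 0
       + (\<Sum>i\<in>{1, 2}. of_nat (card (S i - (S 0 \<union> Q))) * \<delta> i)"
| "lhs \<delta> z (D2 Q) =
     - (\<Sum>j\<in>Q. z j) + (\<Sum>i\<in>{1, 2}. of_int (l + int (card (Q \<union> S i)) - n) * \<delta> i)
       + of_int (n - int (card (Q \<union> S 0)) - l) * \<delta> 3"
| "lhs \<delta> z (D3 i k Q) =
     - (\<Sum>j\<in>Q. z j) + \<delta> 0 - \<delta> i + of_int (l + int (card (Q \<union> S k)) - 1 - n) * \<delta> k + \<delta> 3"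
| "lhs \<delta> z (D4 i Q) =
     - (\<Sum>j\<in>Q. z j) + of_int (l + int (card (Q \<union> S i)) - n) * \<delta> i
       + of_nat (card (S 3 - (S i \<union> Q))) * \<delta> 3"
| "lhs \<delta> z (D5 Q) =
     - (\<Sum>j\<in>Q. z j) + of_int (l + int (card (Q \<union> S 3)) - n) * \<delta> 3"

definition rhs :: "'a ineq \<Rightarrow> 'b::linordered_field" where
  "rhs q = (if family q \<le> 5 then of_int u else 0)"

definition most_violated ::
    "nat \<Rightarrow> (nat \<Rightarrow> 'b::linordered_field) \<Rightarrow> ('a \<Rightarrow> 'b) \<Rightarrow> 'a ineq \<Rightarrow> bool" where
  "most_violated f \<delta> z q \<longleftrightarrow>
     is_arg_max (\<lambda>q. lhs \<delta> z q - rhs q) (\<lambda>q. admissible q \<and> family q = f) q"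

definition satisfies :: "(nat \<Rightarrow> 'b::linordered_field) \<Rightarrow> ('a \<Rightarrow> 'b) \<Rightarrow> 'a ineq \<Rightarrow> bool" where
  "satisfies \<delta> z q \<longleftrightarrow> lhs \<delta> z q \<le> rhs q"

end


section \<open>Polynomial time\<close>

text \<open>
  The machine model is the random access machine with logarithmic cost (Aho, Hopcroft, Ullman),
  with structured control flow instead of jumps: finitely many registers (those named in the
  program), an integer-addressed memory of integers, and a write-only output tape. Every value
  that is read or computed, addresses included, is charged its binary length, so that polynomial
  cost is the same as polynomial time on a Turing machine.
\<close>

definition bit_size :: "int \<Rightarrow> nat" where
  "bit_size k = 1 + floorlog 2 (nat \<bar>k\<bar>)"

record state =
  regs :: "nat \<Rightarrow> int"
  mem :: "int \<Rightarrow> int"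
  out :: "int list"

datatype expr =
    Const int
  | Reg nat
  | Mem expr
  | Plus expr expr
  | Minus expr expr
  | Times expr expr

fun val :: "expr \<Rightarrow> state \<Rightarrow> int" where
  "val (Const c) s = c"
| "val (Reg r) s = regs s r"
| "val (Mem e) s = mem s (val e s)"
| "val (Plus e1 e2) s = val e1 s + val e2 s"
| "val (Minus e1 e2) s = val e1 s - val e2 s"
| "val (Times e1 e2) s = val e1 s * val e2 s"

fun val_cost :: "expr \<Rightarrow> state \<Rightarrow> nat" where
  "val_cost (Const c) s = bit_size c"
| "val_cost (Reg r) s = bit_size (regs s r)"
| "val_cost (Mem e) s = val_cost e s + bit_size (mem s (val e s))"
| "val_cost (Plus e1 e2) s = val_cost e1 s + val_cost e2 s + bit_size (val e1 s + val e2 s)"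
| "val_cost (Minus e1 e2) s = val_cost e1 s + val_cost e2 s + bit_size (val e1 s - val e2 s)"
| "val_cost (Times e1 e2) s = val_cost e1 s + val_cost e2 s + bit_size (val e1 s * val e2 s)"

datatype prog =
    Skip
  | Assign nat expr
  | Store expr expr
  | Write expr
  | Seq prog prog
  | IfPos expr prog prog
  | WhilePos expr prog

text \<open>\<open>exec c s t s'\<close>: started in state \<open>s\<close>, the program \<open>c\<close> halts in state \<open>s'\<close> at total cost \<open>t\<close>.\<close>

inductive exec :: "prog \<Rightarrow> state \<Rightarrow> nat \<Rightarrow> state \<Rightarrow> bool" where
  Skip: "exec Skip s 1 s"
| Assign: "exec (Assign r e) s (val_cost e s) (s\<lparr>regs := (regs s)(r := val e s)\<rparr>)"
| Store: "exec (Store a e) s (val_cost a s + val_cost e s)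
    (s\<lparr>mem := (mem s)(val a s := val e s)\<rparr>)"
| Write: "exec (Write e) s (val_cost e s) (s\<lparr>out := out s @ [val e s]\<rparr>)"
| Seq: "exec c1 s t1 s1 \<Longrightarrow> exec c2 s1 t2 s2 \<Longrightarrow> exec (Seq c1 c2) s (t1 + t2) s2"
| IfTrue: "val e s > 0 \<Longrightarrow> exec c1 s t s1 \<Longrightarrow> exec (IfPos e c1 c2) s (val_cost e s + t) s1"
| IfFalse: "\<not> val e s > 0 \<Longrightarrow> exec c2 s t s1 \<Longrightarrow> exec (IfPos e c1 c2) s (val_cost e s + t) s1"
| WhileTrue: "val e s > 0 \<Longrightarrow> exec c s t1 s1 \<Longrightarrow> exec (WhilePos e c) s1 t2 s2
    \<Longrightarrow> exec (WhilePos e c) s (val_cost e s + t1 + t2) s2"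
| WhileFalse: "\<not> val e s > 0 \<Longrightarrow> exec (WhilePos e c) s (val_cost e s) s"

text \<open>Programs are deterministic, so the existential over runs in \<open>poly_time_solvable\<close> below
  speaks about the unique run of the program.\<close>

lemma exec_deterministic:
  "exec c s t s' \<Longrightarrow> exec c s t' s'' \<Longrightarrow> t' = t \<and> s'' = s'"
proof (induction arbitrary: t' s'' rule: exec.induct)
  case (Skip s)
  from Skip.prems show ?case by cases simp_all
next
  case (Assign r e s)
  from Assign.prems show ?case by cases simp_all
next
  case (Store a e s)
  from Store.prems show ?case by cases simp_all
next
  case (Write e s)
  from Write.prems show ?case by cases simp_all
next
  case (Seq c1 s t1 s1 c2 t2 s2)
  from Seq.prems show ?case by cases (metis Seq.IH)
next
  case (IfTrue e s c1 t s1 c2)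
  from IfTrue.prems IfTrue.hyps(1) show ?case by cases (metis IfTrue.IH, simp)
next
  case (IfFalse e s c2 t s1 c1)
  from IfFalse.prems IfFalse.hyps(1) show ?case by cases (simp, metis IfFalse.IH)
next
  case (WhileTrue e s c t1 s1 t2 s2)
  from WhileTrue.prems WhileTrue.hyps(1) show ?case by cases (metis WhileTrue.IH, simp)
next
  case (WhileFalse e s c)
  from WhileFalse.prems WhileFalse.hyps(1) show ?case by cases simp_all
qed

definition init_state :: "int list \<Rightarrow> state" where
  "init_state xs =
     \<lparr>regs = (\<lambda>_. 0),
      mem = (\<lambda>a. if 0 \<le> a \<and> a < int (length xs) then xs ! nat a else 0),
      out = []\<rparr>"

definition input_size :: "int list \<Rightarrow> nat" where
  "input_size xs = (\<Sum>x\<leftarrow>xs. bit_size x)"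

text \<open>Some program, given any instance \<open>x \<in> X\<close> encoded by \<open>enc\<close>, halts in time polynomial in the
  binary length of the input and outputs a list \<open>ys\<close> with \<open>R x ys\<close>.\<close>

definition poly_time_solvable ::
    "'x set \<Rightarrow> ('x \<Rightarrow> int list) \<Rightarrow> ('x \<Rightarrow> int list \<Rightarrow> bool) \<Rightarrow> bool" where
  "poly_time_solvable X enc R \<longleftrightarrow>
     (\<exists>c. \<exists>p :: nat poly. \<forall>x\<in>X. \<exists>t s'.
        exec c (init_state (enc x)) t s' \<and> t \<le> poly p (input_size (enc x)) \<and> R x (out s'))"


section \<open>Encodings\<close>

text \<open>
  The list \<open>js\<close> enumerates the ground set \<open>J\<close> without repetition. Subsets of \<open>J\<close> are encoded by
  their characteristic vectors along \<open>js\<close>, rationals by numerator and denominator in lowest terms.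
\<close>

type_synonym 'a input =
  "'a set \<times> 'a set \<times> 'a set \<times> int \<times> int \<times> 'a list \<times> (nat \<Rightarrow> rat) \<times> ('a \<Rightarrow> rat)"

definition inputs :: "'a input set" where
  "inputs = {(J, S1, S2, l, u, js, \<delta>, z). setting J S1 S2 l u \<and> distinct js \<and> set js = J}"

definition inputs_AB :: "'a input set" where
  "inputs_AB = {(J, S1, S2, l, u, js, \<delta>, z) \<in> inputs.
     setting.satisfies_A \<delta> \<and> setting.satisfies_B J S1 S2 l u \<delta> z}"

definition encode_rat :: "rat \<Rightarrow> int list" where
  "encode_rat q = [fst (quotient_of q), snd (quotient_of q)]"

fun encode_input :: "'a input \<Rightarrow> int list" where
  "encode_input (J, S1, S2, l, u, js, \<delta>, z) =
     [int (length js), l, u] @ concat (map (\<lambda>i. encode_rat (\<delta> i)) [0, 1, 2, 3])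
     @ concat (map (\<lambda>j. [of_bool (j \<in> S1), of_bool (j \<in> S2)] @ encode_rat (z j)) js)"

definition encode_set :: "'a list \<Rightarrow> 'a set \<Rightarrow> int list" where
  "encode_set js Q = map (\<lambda>j. of_bool (j \<in> Q)) js"

fun encode_ineq :: "'a list \<Rightarrow> 'a ineq \<Rightarrow> int list" where
  "encode_ineq js (C1 Q) = 1 # encode_set js Q"
| "encode_ineq js (C2 Q) = 2 # encode_set js Q"
| "encode_ineq js (C3 i k Q) = 3 # int i # int k # encode_set js Q"
| "encode_ineq js (C4 i Q) = 4 # int i # encode_set js Q"
| "encode_ineq js (C5 Q) = 5 # encode_set js Q"
| "encode_ineq js (D1 Q) = 6 # encode_set js Q"
| "encode_ineq js (D2 Q) = 7 # encode_set js Q"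
| "encode_ineq js (D3 i k Q) = 8 # int i # int k # encode_set js Q"
| "encode_ineq js (D4 i Q) = 9 # int i # encode_set js Q"
| "encode_ineq js (D5 Q) = 10 # encode_set js Q"

fun outputs_most_violated :: "nat \<Rightarrow> 'a input \<Rightarrow> int list \<Rightarrow> bool" where
  "outputs_most_violated f (J, S1, S2, l, u, js, \<delta>, z) ys \<longleftrightarrow>
     (\<exists>q. setting.most_violated J S1 S2 l u f \<delta> z q \<and> ys = encode_ineq js q)"

text \<open>The answer \<open>[0]\<close> means that the point satisfies all inequalities of all ten families; it is
  distinct from the encoding of any inequality.\<close>

fun separates :: "'a input \<Rightarrow> int list \<Rightarrow> bool" where
  "separates (J, S1, S2, l, u, js, \<delta>, z) ys \<longleftrightarrow>
     (if \<forall>q. setting.admissible J S1 S2 l u q \<longrightarrow> setting.satisfies J S1 S2 l u \<delta> z q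
      then ys = [0]
      else \<exists>q. setting.admissible J S1 S2 l u q \<and> \<not> setting.satisfies J S1 S2 l u \<delta> z q
             \<and> ys = encode_ineq js q)"

end

theory Submission
  imports Defs
begin

text \<open>
  Put \<open>P = Q\<close> for a C-family and \<open>P = J - Q\<close> for a D-family. Then the excess of the left-hand side over
  the right-hand side is a constant plus \<open>\<Sum>j\<in>P. w j\<close>, where the weight of \<open>j\<close> depends only on \<open>z j\<close>,
  on \<open>\<delta>\<close> and on the membership of \<open>j\<close> in \<open>S1\<close> and \<open>S2\<close>; Di arises from Ci by replacing \<open>u\<close> by \<open>l\<close>,
  up to the constant. Admissibility becomes a cardinality constraint \<open>card (P \<inter> U) \<le> c\<close> (with \<open>c = 0\<close> for
  C3 and D3). So a most violated inequality is found greedily: take the elements of positive weight,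
  those in \<open>U\<close> only if fewer than \<open>c\<close> elements of \<open>U\<close> precede them in the order by weight. The
  rank of an element is recounted whenever it is needed, so no memory is written, and weights are
  compared as fractions recomputed from the input; only the running value of the objective grows,
  by a linear number of bits per step.
\<close>

section \<open>Costs of expressions and programs\<close>

text \<open>Complementing \<open>Q\<close> turns D into C because J - (Q union S_i) = (J - Q) - S_i,
  so lower bounds on |Q union S_i| become upper bounds on |P - S_i|. The greedy set is optimal
  because the constraint touches only \<open>U\<close>: outside \<open>U\<close> every positive
  weight can be taken freely, inside \<open>U\<close> the best positive ones fill the slots. One
  greedy set settles a single choice of indices. The objective value is needed in two situations: to
  choose between the two index choices of C3, C4, D3, D4, and to test for a positive excess in the
  separation problem. The obstacle is the bit cost. The memory always equals the input, so an
  expression that reads only cells, indices, ranks and flags has size linear in the input size L.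
  Only the fraction for the objective compounds, because it is never reduced; a linear number of
  bits in each of at most L steps gives a quadratic bound. Given one bound on loop counts and one on
  bit sizes, the cost is then read off the program text, which makes it polynomial without any
  analysis of particular programs.\<close>

lemma bit_size_ge_1: "1 \<le> bit_size k"
  by (simp add: bit_size_def)

text \<open>The rules for monotonicity, sums and products below all go through this form, where a
  size bound is an inequality against a power of two.\<close>

lemma bit_size_le_Suc_iff: "bit_size k \<le> Suc m \<longleftrightarrow> \<bar>k\<bar> < 2 ^ m"
proof -
  have "bit_size k \<le> Suc m \<longleftrightarrow> floorlog 2 (nat \<bar>k\<bar>) \<le> m"
    by (simp add: bit_size_def)
  also have "\<dots> \<longleftrightarrow> nat \<bar>k\<bar> < 2 ^ m"
    by (simp add: floorlog_le_iff)
  also have "\<dots> \<longleftrightarrow> \<bar>k\<bar> < 2 ^ m"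
    by (simp add: nat_less_iff)
  finally show ?thesis .
qed

lemma abs_less_bit_size: "\<bar>k\<bar> < 2 ^ (bit_size k - 1)"
  using bit_size_le_Suc_iff[of k "bit_size k - 1"] bit_size_ge_1[of k] by simp

lemma bit_size_mono: "\<bar>a\<bar> \<le> \<bar>b\<bar> \<Longrightarrow> bit_size a \<le> bit_size b"
  using abs_less_bit_size[of b] bit_size_le_Suc_iff[of a "bit_size b - 1"] bit_size_ge_1[of b]
  by simp

lemma bit_size_add: "bit_size (a + b) \<le> Suc (max (bit_size a) (bit_size b))"
proof -
  define m where "m = max (bit_size a) (bit_size b)"
  have m: "bit_size a \<le> Suc (m - 1)" "bit_size b \<le> Suc (m - 1)" "1 \<le> m"
    using bit_size_ge_1[of a] by (auto simp: m_def)
  then have "\<bar>a + b\<bar> < 2 * 2 ^ (m - 1)"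
    unfolding bit_size_le_Suc_iff by linarith
  also have "\<dots> = 2 ^ m"
    using m(3) by (metis One_nat_def Suc_pred' power_Suc zero_less_one less_le_trans)
  finally show ?thesis
    by (simp add: bit_size_le_Suc_iff m_def)
qed

lemma bit_size_minus: "bit_size (- a) = bit_size a"
  by (simp add: bit_size_def)

lemma bit_size_diff: "bit_size (a - b) \<le> Suc (max (bit_size a) (bit_size b))"
  using bit_size_add[of a "- b"] by (simp add: bit_size_minus)

lemma bit_size_mult: "bit_size (a * b) \<le> bit_size a + bit_size b"
proof -
  have "\<bar>a\<bar> * \<bar>b\<bar> \<le> 2 ^ (bit_size a - 1) * 2 ^ (bit_size b - 1)"
    using abs_less_bit_size[of a] abs_less_bit_size[of b] by (intro mult_mono) auto
  also have "\<dots> < 2 ^ (bit_size a + bit_size b - 1)"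
    using bit_size_ge_1[of a] bit_size_ge_1[of b] by (simp flip: power_add)
  finally show ?thesis
    using bit_size_le_Suc_iff[of "a * b" "bit_size a + bit_size b - 1"] bit_size_ge_1[of a]
    by (simp add: abs_mult)
qed

lemma bit_size_le_val_cost: "bit_size (val e s) \<le> val_cost e s"
  by (cases e) auto

fun expr_regs :: "expr \<Rightarrow> nat set" where
  "expr_regs (Const c) = {}"
| "expr_regs (Reg r) = {r}"
| "expr_regs (Mem e) = expr_regs e"
| "expr_regs (Plus e1 e2) = expr_regs e1 \<union> expr_regs e2"
| "expr_regs (Minus e1 e2) = expr_regs e1 \<union> expr_regs e2"
| "expr_regs (Times e1 e2) = expr_regs e1 \<union> expr_regs e2"

text \<open>The factor 2 pays for the result of an operation: its size is at most the sum of the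
  operand sizes, since \<open>Suc (max a b) <= a + b\<close> for sizes, which are at least
  1.\<close>

fun expr_factor :: "expr \<Rightarrow> nat" where
  "expr_factor (Const c) = bit_size c"
| "expr_factor (Reg r) = 1"
| "expr_factor (Mem e) = expr_factor e + 1"
| "expr_factor (Plus e1 e2) = 2 * (expr_factor e1 + expr_factor e2)"
| "expr_factor (Minus e1 e2) = 2 * (expr_factor e1 + expr_factor e2)"
| "expr_factor (Times e1 e2) = 2 * (expr_factor e1 + expr_factor e2)"

text \<open>Only the registers that \<open>e\<close> reads are bounded. An expression that avoids
  the growing registers thus gets a bound independent of them.\<close>

lemma val_cost_le_local:
  assumes "\<And>a. bit_size (mem s a) \<le> B" and "\<And>r. r \<in> expr_regs e \<Longrightarrow> bit_size (regs s r) \<le> B"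
  shows "val_cost e s \<le> expr_factor e * B"
  using assms(2)
proof (induction e)
  case (Const c)
  \<comment> \<open>Cell 0 serves to obtain \<open>1 <= B\<close>; a constant reads nothing that
    would give it.\<close>
  then show ?case using assms(1)[of 0] bit_size_ge_1[of "mem s 0"] by simp
next
  case (Mem e)
  then show ?case using assms(1)[of "val e s"] by simp
next
  case (Plus e1 e2)
  then show ?case
    using bit_size_add[of "val e1 s" "val e2 s"] bit_size_le_val_cost[of e1 s]
      bit_size_le_val_cost[of e2 s] bit_size_ge_1[of "val e1 s"] bit_size_ge_1[of "val e2 s"]
    by (fastforce simp: algebra_simps)
next
  case (Minus e1 e2)
  then show ?case
    using bit_size_diff[of "val e1 s" "val e2 s"] bit_size_le_val_cost[of e1 s]
      bit_size_le_val_cost[of e2 s] bit_size_ge_1[of "val e1 s"] bit_size_ge_1[of "val e2 s"]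
    by (fastforce simp: algebra_simps)
next
  case (Times e1 e2)
  then show ?case
    using bit_size_mult[of "val e1 s" "val e2 s"] bit_size_le_val_cost[of e1 s]
      bit_size_le_val_cost[of e2 s]
    by (fastforce simp: algebra_simps)
qed auto

definition bounded :: "nat \<Rightarrow> state \<Rightarrow> bool" where
  "bounded B s \<longleftrightarrow> (\<forall>r. bit_size (regs s r) \<le> B) \<and> (\<forall>a. bit_size (mem s a) \<le> B)"

lemma val_cost_le: "bounded B s \<Longrightarrow> val_cost e s \<le> expr_factor e * B"
  by (rule val_cost_le_local) (auto simp: bounded_def)

lemma bounded_regs_upd:
  "bounded B s \<Longrightarrow> bit_size v \<le> B \<Longrightarrow> bounded B (s\<lparr>regs := (regs s)(r := v)\<rparr>)"
  by (simp add: bounded_def)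

lemma bounded_out_upd [simp]: "bounded B (s\<lparr>out := ys\<rparr>) = bounded B s"
  by (simp add: bounded_def)

text \<open>\<open>N\<close> bounds the iterations of every loop and \<open>B\<close> the size of
  every value; nested loops multiply. The extra iteration in the \<open>WhilePos\<close> case covers
  the last, failing test of the guard.\<close>

fun prog_cost :: "prog \<Rightarrow> nat \<Rightarrow> nat \<Rightarrow> nat" where
  "prog_cost Skip N B = 1"
| "prog_cost (Assign r e) N B = expr_factor e * B"
| "prog_cost (Store a e) N B = (expr_factor a + expr_factor e) * B"
| "prog_cost (Write e) N B = expr_factor e * B"
| "prog_cost (Seq c1 c2) N B = prog_cost c1 N B + prog_cost c2 N B"
| "prog_cost (IfPos e c1 c2) N B = expr_factor e * B + (prog_cost c1 N B + prog_cost c2 N B)"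
| "prog_cost (WhilePos e c) N B = (N + 1) * (expr_factor e * B + prog_cost c N B)"

text \<open>For a fixed program the nesting depth is fixed, so the products in
  \<open>prog_cost\<close> have bounded degree. Loop counts are taken as \<open>x\<close> itself,
  bit sizes as a polynomial in \<open>x\<close>.\<close>

lemma prog_cost_poly: "\<exists>p. \<forall>x. prog_cost c x (poly b x) = poly p x"
proof (induction c)
  case Skip
  show ?case by (rule exI[of _ 1]) simp
next
  case (Assign r e)
  show ?case by (rule exI[of _ "smult (expr_factor e) b"]) simp
next
  case (Store a e)
  show ?case by (rule exI[of _ "smult (expr_factor a + expr_factor e) b"]) simp
next
  case (Write e)
  show ?case by (rule exI[of _ "smult (expr_factor e) b"]) simp
next
  case (Seq c1 c2)
  then obtain p q where "\<forall>x. prog_cost c1 x (poly b x) = poly p x"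
    "\<forall>x. prog_cost c2 x (poly b x) = poly q x" by blast
  then show ?case by (intro exI[of _ "p + q"]) simp
next
  case (IfPos e c1 c2)
  then obtain p q where "\<forall>x. prog_cost c1 x (poly b x) = poly p x"
    "\<forall>x. prog_cost c2 x (poly b x) = poly q x" by blast
  then show ?case by (intro exI[of _ "smult (expr_factor e) b + (p + q)"]) simp
next
  case (WhilePos e c)
  then obtain p where "\<forall>x. prog_cost c x (poly b x) = poly p x" by blast
  then show ?case
    by (intro exI[of _ "[:1, 1:] * (smult (expr_factor e) b + p)"]) (simp add: algebra_simps)
qed

section \<open>Total correctness rules with the cost bound built in\<close>

definition wp :: "nat \<Rightarrow> nat \<Rightarrow> prog \<Rightarrow> (state \<Rightarrow> bool) \<Rightarrow> state \<Rightarrow> bool" where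
  "wp N B c Q s \<longleftrightarrow> (\<exists>t s'. exec c s t s' \<and> t \<le> prog_cost c N B \<and> Q s')"

lemma wp_mono: "wp N B c Q s \<Longrightarrow> (\<And>s'. Q s' \<Longrightarrow> R s') \<Longrightarrow> wp N B c R s"
  unfolding wp_def by blast

lemma wp_Skip: "Q s \<Longrightarrow> wp N B Skip Q s"
  unfolding wp_def using exec.Skip by (intro exI[of _ 1] exI[of _ s]) simp

lemma wp_Assign:
  "bounded B s \<Longrightarrow> Q (s\<lparr>regs := (regs s)(r := val e s)\<rparr>) \<Longrightarrow> wp N B (Assign r e) Q s"
  unfolding wp_def using exec.Assign val_cost_le by fastforce

lemma wp_Write:
  "bounded B s \<Longrightarrow> Q (s\<lparr>out := out s @ [val e s]\<rparr>) \<Longrightarrow> wp N B (Write e) Q s"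
  unfolding wp_def using exec.Write val_cost_le by fastforce

lemma wp_Seq: "wp N B c1 (wp N B c2 Q) s \<Longrightarrow> wp N B (Seq c1 c2) Q s"
  unfolding wp_def by (fastforce intro: exec.Seq add_mono)

lemma wp_IfPos:
  assumes "bounded B s" and "val e s > 0 \<Longrightarrow> wp N B c1 Q s" and "\<not> val e s > 0 \<Longrightarrow> wp N B c2 Q s"
  shows "wp N B (IfPos e c1 c2) Q s"
proof (cases "val e s > 0")
  case True
  then obtain t s' where "exec c1 s t s'" "t \<le> prog_cost c1 N B" "Q s'"
    using assms(2) by (auto simp: wp_def)
  then show ?thesis
    unfolding wp_def using True exec.IfTrue[OF True] val_cost_le[OF assms(1), of e]
    by (intro exI[of _ "val_cost e s + t"] exI[of _ s']) auto
next
  case False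
  then obtain t s' where "exec c2 s t s'" "t \<le> prog_cost c2 N B" "Q s'"
    using assms(3) by (auto simp: wp_def)
  then show ?thesis
    unfolding wp_def using False exec.IfFalse[OF False] val_cost_le[OF assms(1), of e]
    by (intro exI[of _ "val_cost e s + t"] exI[of _ s']) auto
qed

text \<open>The induction is on the number \<open>k\<close> of iterations left:
  \<open>WhileTrue\<close> peels off the first iteration, while \<open>Inv\<close> is indexed by the
  number already done.\<close>

lemma exec_while:
  assumes inv: "\<And>i s. i \<le> m \<Longrightarrow> Inv i s \<Longrightarrow> bounded B s \<and> (val e s > 0 \<longleftrightarrow> i < m)"
    and step: "\<And>i s. i < m \<Longrightarrow> Inv i s \<Longrightarrow> wp N B c (Inv (Suc i)) s"
  shows "k \<le> m \<Longrightarrow> Inv (m - k) s \<Longrightarrow>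
    \<exists>t s'. exec (WhilePos e c) s t s' \<and> Inv m s'
      \<and> t \<le> k * (expr_factor e * B + prog_cost c N B) + expr_factor e * B"
proof (induction k arbitrary: s)
  case 0
  then show ?case
    using inv[of m s] val_cost_le[of B s e] exec.WhileFalse[of e s c]
    by (intro exI[of _ "val_cost e s"] exI[of _ s]) auto
next
  case (Suc k)
  then have pos: "val e s > 0" and bd: "bounded B s"
    using inv[of "m - Suc k" s] by auto
  obtain t1 s1 where 1: "exec c s t1 s1" "t1 \<le> prog_cost c N B" "Inv (Suc (m - Suc k)) s1"
    using step[of "m - Suc k" s] Suc.prems by (auto simp: wp_def)
  have "Suc (m - Suc k) = m - k" using Suc.prems by simp
  then obtain t2 s2 where 2: "exec (WhilePos e c) s1 t2 s2" "Inv m s2"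
    "t2 \<le> k * (expr_factor e * B + prog_cost c N B) + expr_factor e * B"
    using Suc.IH[of s1] Suc.prems 1(3) by auto
  have "exec (WhilePos e c) s (val_cost e s + t1 + t2) s2"
    by (rule exec.WhileTrue[OF pos 1(1) 2(1)])
  moreover have "val_cost e s + t1 + t2
      \<le> Suc k * (expr_factor e * B + prog_cost c N B) + expr_factor e * B"
    using val_cost_le[OF bd, of e] 1(2) 2(3) by simp
  ultimately show ?case using 2(2) by blast
qed

text \<open>Cell 0 holds \<open>n\<close> in the encoding, so every such loop runs over the ground
  set.\<close>

definition For :: "nat \<Rightarrow> prog \<Rightarrow> prog" where
  "For r c = Seq (Assign r (Const 0))
     (WhilePos (Minus (Mem (Const 0)) (Reg r)) (Seq c (Assign r (Plus (Reg r) (Const 1)))))"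

text \<open>The body must establish \<open>Inv (Suc i)\<close> for the state with the counter
  already advanced, so that its users never handle the increment.\<close>

lemma wp_For:
  assumes bd: "bounded B s" and init: "Inv 0 (s\<lparr>regs := (regs s)(r := 0)\<rparr>)"
    and inv: "\<And>i s. i \<le> m \<Longrightarrow> Inv i s \<Longrightarrow> bounded B s \<and> mem s 0 = int m"
    and step: "\<And>i s. i < m \<Longrightarrow> Inv i s \<Longrightarrow> regs s r = int i \<Longrightarrow>
      wp N B c (\<lambda>s'. bounded B s' \<and> regs s' r = int i
        \<and> Inv (Suc i) (s'\<lparr>regs := (regs s')(r := int (Suc i))\<rparr>)) s"
    and N: "m \<le> N"
  shows "wp N B (For r c) (Inv m) s"
proof -
  let ?e = "Minus (Mem (Const 0)) (Reg r)"
  let ?c = "Seq c (Assign r (Plus (Reg r) (Const 1)))"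
  let ?I = "\<lambda>i s. Inv i s \<and> regs s r = int i"
  have step': "wp N B ?c (?I (Suc i)) s" if "i < m" "?I i s" for i s
    using that
    by (intro wp_Seq wp_mono[OF step]) (auto intro!: wp_Assign simp: add.commute)
  have "wp N B (WhilePos ?e ?c) (Inv m) (s\<lparr>regs := (regs s)(r := 0)\<rparr>)"
  proof -
    obtain t s' where *: "exec (WhilePos ?e ?c) (s\<lparr>regs := (regs s)(r := 0)\<rparr>) t s'" "Inv m s'"
      "t \<le> m * (expr_factor ?e * B + prog_cost ?c N B) + expr_factor ?e * B"
      using exec_while[of m ?I B ?e N ?c m "s\<lparr>regs := (regs s)(r := 0)\<rparr>"] inv init step'
      by auto
    have "m * (expr_factor ?e * B + prog_cost ?c N B) + expr_factor ?e * B
        \<le> (m + 1) * (expr_factor ?e * B + prog_cost ?c N B)"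
      by simp
    also have "\<dots> \<le> (N + 1) * (expr_factor ?e * B + prog_cost ?c N B)"
      by (rule mult_right_mono) (use N in auto)
    finally have "t \<le> prog_cost (WhilePos ?e ?c) N B"
      using *(3) by simp
    then show ?thesis using *(1,2) unfolding wp_def by blast
  qed
  then show ?thesis
    unfolding For_def by (intro wp_Seq wp_Assign bd) simp
qed

section \<open>Greedy maximization under a cardinality constraint\<close>

text \<open>Breaking ties by index makes this a strict total order. Without it, tied elements would
  share a rank and more than \<open>c\<close> of them could pass the test in
  \<open>greedy\<close>.\<close>

definition beats :: "('b \<Rightarrow> rat) \<Rightarrow> 'b::linorder \<Rightarrow> 'b \<Rightarrow> bool" where
  "beats w k j \<longleftrightarrow> w j < w k \<or> (w k = w j \<and> k < j)"

text \<open>The rank counts rivals of every sign; this is harmless, since whatever beats an element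
  of positive weight has positive weight itself.\<close>

definition greedy :: "('b::linorder \<Rightarrow> rat) \<Rightarrow> 'b set \<Rightarrow> 'b set \<Rightarrow> nat \<Rightarrow> 'b set" where
  "greedy w A U c = {j \<in> A. 0 < w j \<and> (j \<in> U \<longrightarrow> card {k \<in> A \<inter> U. beats w k j} < c)}"

lemma ex_beats_all: "finite U \<Longrightarrow> U \<noteq> {} \<Longrightarrow> \<exists>m\<in>U. \<forall>k\<in>U. k \<noteq> m \<longrightarrow> beats w m k"
proof (induction U rule: finite_ne_induct)
  case (insert x U)
  then obtain m where m: "m \<in> U" "\<forall>k\<in>U. k \<noteq> m \<longrightarrow> beats w m k" by blast
  show ?case
  proof (cases "beats w m x")
    case True
    then show ?thesis using m by auto
  next
    case False
    then have "beats w x m" using insert.hyps m(1) unfolding beats_def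
      by (metis linorder_neqE)
    then have "beats w x k" if "k \<in> U" for k
      using m that unfolding beats_def by fastforce
    then show ?thesis by auto
  qed
qed simp

text \<open>Induction peels off the element \<open>m\<close> that beats all others. Removing it
  lowers every other rank by exactly one, which matches lowering \<open>c\<close> by one. A
  competitor loses at most \<open>w m\<close> by giving up one element and is then covered by the
  induction hypothesis.\<close>

lemma greedy_capped:
  assumes "finite U"
  shows "card (greedy w U U c) \<le> c \<and> (\<forall>P\<subseteq>U. card P \<le> c \<longrightarrow> sum w P \<le> sum w (greedy w U U c))"
  using assms
proof (induction "card U" arbitrary: U c)
  case 0
  then show ?case by (auto simp: greedy_def)
next
  case (Suc N)
  then obtain m where m: "m \<in> U" "\<And>k. k \<in> U \<Longrightarrow> k \<noteq> m \<Longrightarrow> beats w m k"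
    using ex_beats_all[of U w] by force
  have fin: "finite P" if "P \<subseteq> U" for P using that Suc.prems finite_subset by blast
  have max: "w k \<le> w m" if "k \<in> U" for k
    using m(2)[OF that] by (cases "k = m") (auto simp: beats_def)
  show ?case
  proof (cases "0 < w m \<and> 0 < c")
    \<comment> \<open>Either no slot is left or even the largest weight is not positive, so the
      empty set is optimal.\<close>
    case False
    then have "greedy w U U c = {}" using max by (force simp: greedy_def)
    moreover have "sum w P \<le> 0" if "P \<subseteq> U" "card P \<le> c" for P
    proof (cases "c = 0")
      case True
      then show ?thesis using that fin[of P] by simp
    next
      case False
      then have "w m \<le> 0" using \<open>\<not> (0 < w m \<and> 0 < c)\<close> by auto
      then show ?thesis using max that by (intro sum_nonpos) force
    qed
    ultimately show ?thesis by simp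
  next
    case True
    let ?U = "U - {m}" and ?c = "c - 1"
    have rank: "card {k \<in> U. beats w k j} = Suc (card {k \<in> ?U. beats w k j})" if "j \<in> ?U" for j
    proof -
      have "{k \<in> U. beats w k j} = insert m {k \<in> ?U. beats w k j}"
        using m that by auto
      then show ?thesis using Suc.prems by simp
    qed
    have not_beaten: "\<not> beats w k m" if "k \<in> U" for k
    proof (cases "k = m")
      case False
      then have "beats w m k" using m(2) that by blast
      then show ?thesis by (auto simp: beats_def)
    qed (simp add: beats_def)
    have eq: "greedy w U U c = insert m (greedy w ?U ?U ?c)" (is "?L = insert m ?R")
    proof -
      have "j \<in> ?L \<longleftrightarrow> j \<in> insert m ?R" for j
      proof (cases "j = m")
        case True
        have "{k \<in> U. beats w k m} = {}" using not_beaten by blast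
        then have "card {k \<in> U. beats w k m} = 0" by (simp only: card.empty)
        then have "m \<in> ?L"
          unfolding greedy_def Int_absorb using m(1) \<open>0 < w m \<and> 0 < c\<close> by simp
        then show ?thesis using True by simp
      next
        case False
        then show ?thesis using rank[of j] by (auto simp: greedy_def)
      qed
      then show ?thesis by blast
    qed
    have notin: "m \<notin> ?R" by (simp add: greedy_def)
    have finR: "finite ?R" using Suc.prems by (simp add: greedy_def)
    have IH: "card ?R \<le> ?c" "\<And>P. P \<subseteq> ?U \<Longrightarrow> card P \<le> ?c \<Longrightarrow> sum w P \<le> sum w ?R"
      using Suc.hyps(1)[of ?U ?c] Suc.hyps(2) Suc.prems m(1) by auto
    have "sum w P \<le> w m + sum w ?R" if P: "P \<subseteq> U" "card P \<le> c" for P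
    proof (cases "P = {}")
      case True
      have "0 \<le> sum w ?R" using IH(2)[of "{}"] by simp
      then show ?thesis using True \<open>0 < w m \<and> 0 < c\<close> by simp
    next
      case False
      \<comment> \<open>The element given up is \<open>m\<close> if \<open>P\<close> contains it and
        arbitrary otherwise; in both cases \<open>P - {x}\<close> avoids \<open>m\<close>.\<close>
      then obtain x where x: "x \<in> P" "m \<in> P \<longrightarrow> x = m" by blast
      then have "sum w P = w x + sum w (P - {x})" "card (P - {x}) \<le> ?c"
        using sum.remove[OF fin[OF P(1)] x(1), of w] P(2) by auto
      moreover have "P - {x} \<subseteq> ?U" using P(1) x by auto
      moreover have "w x \<le> w m" using P(1) x(1) by (intro max) auto
      ultimately show ?thesis using IH(2)[of "P - {x}"] by simp
    qed
    moreover have "sum w (insert m ?R) = w m + sum w ?R" using notin finR by simp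
    moreover have "card (insert m ?R) \<le> c" using IH(1) notin finR True by fastforce
    ultimately show ?thesis unfolding eq by presburger
  qed
qed

lemma greedy_Int: "greedy w A U c \<inter> U = greedy w (A \<inter> U) (A \<inter> U) c"
  by (auto simp: greedy_def)

lemma card_greedy_Int_le: "finite A \<Longrightarrow> card (greedy w A U c \<inter> U) \<le> c"
  using greedy_capped[of "A \<inter> U" w c] by (simp add: greedy_Int)

text \<open>The constraint sees only \<open>P \<inter> U\<close>, so the parts inside and outside
  \<open>U\<close> are optimized independently.\<close>

lemma sum_le_sum_greedy:
  assumes A: "finite A" and P: "P \<subseteq> A" "card (P \<inter> U) \<le> c"
  shows "sum w P \<le> sum w (greedy w A U c)"
proof -
  let ?G = "greedy w A U c"
  have fin: "finite P" "finite ?G"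
    using P(1) A finite_subset by (auto simp: greedy_def)
  have PU: "(A - U) \<inter> P = P - U" "(A - U) \<inter> ?G = ?G - U"
    using P(1) by (auto simp: greedy_def)
  have "sum w (P - U) = (\<Sum>j\<in>A - U. if j \<in> P then w j else 0)"
    unfolding PU(1)[symmetric] by (rule sum.inter_restrict) (use A in simp)
  also have "\<dots> \<le> (\<Sum>j\<in>A - U. if j \<in> ?G then w j else 0)"
    by (rule sum_mono) (auto simp: greedy_def)
  also have "\<dots> = sum w (?G - U)"
    unfolding PU(2)[symmetric] by (rule sum.inter_restrict[symmetric]) (use A in simp)
  finally have "sum w (P - U) \<le> sum w (?G - U)" .
  moreover have "sum w (P \<inter> U) \<le> sum w (?G \<inter> U)"
  proof -
    have "finite (A \<inter> U)" "P \<inter> U \<subseteq> A \<inter> U" using A P(1) by auto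
    then show ?thesis
      using greedy_capped[of "A \<inter> U" w c] P(2) unfolding greedy_Int by blast
  qed
  ultimately show ?thesis
    unfolding sum.Int_Diff[OF fin(1), of w U] sum.Int_Diff[OF fin(2), of w U]
    by (intro add_mono)
qed

section \<open>The families as modular functions\<close>

text \<open>\<open>Shape\<close>\<open>m\<close> stands for both Cm and Dm; a flag \<open>d\<close> tells them apart (\<open>True\<close> for the D-family).\<close>

datatype shape = Shape1 | Shape2 | Shape3 nat nat | Shape4 nat | Shape5

fun ineq_of :: "shape \<Rightarrow> bool \<Rightarrow> 'a set \<Rightarrow> 'a ineq" where
  "ineq_of Shape1 d Q = (if d then D1 Q else C1 Q)"
| "ineq_of Shape2 d Q = (if d then D2 Q else C2 Q)"
| "ineq_of (Shape3 i k) d Q = (if d then D3 i k Q else C3 i k Q)"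
| "ineq_of (Shape4 i) d Q = (if d then D4 i Q else C4 i Q)"
| "ineq_of Shape5 d Q = (if d then D5 Q else C5 Q)"

definition shapes :: "shape set" where
  "shapes = {Shape1, Shape2, Shape3 1 2, Shape3 2 1, Shape4 1, Shape4 2, Shape5}"

text \<open>Membership in each S_i as a function of two bits. Every coefficient then depends on one
  of four kinds of elements and can be tabulated in a program.\<close>

definition in_S :: "nat \<Rightarrow> bool \<Rightarrow> bool \<Rightarrow> bool" where
  "in_S i p q = (if i = 0 then p \<and> q else if i = 1 then p else if i = 2 then q else p \<or> q)"

fun capped :: "shape \<Rightarrow> bool \<Rightarrow> bool \<Rightarrow> bool" where
  "capped Shape1 p q \<longleftrightarrow> \<not> in_S 0 p q"
| "capped Shape2 p q \<longleftrightarrow> False"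
| "capped (Shape3 i k) p q \<longleftrightarrow> in_S i p q \<and> \<not> in_S 0 p q"
| "capped (Shape4 i) p q \<longleftrightarrow> \<not> in_S i p q"
| "capped Shape5 p q \<longleftrightarrow> \<not> in_S 3 p q"

fun cap :: "shape \<Rightarrow> 'b::zero \<Rightarrow> 'b" where
  "cap (Shape3 i k) c = 0"
| "cap _ c = c"

text \<open>Each cardinality in a left-hand side is a sum of indicators over \<open>P\<close>; its
  signed indicator becomes part of the weight of the single element.\<close>

fun elem_coeff :: "shape \<Rightarrow> nat \<Rightarrow> bool \<Rightarrow> bool \<Rightarrow> int" where
  "elem_coeff Shape1 m p q =
     (if m = 0 then - of_bool (\<not> in_S 0 p q)
      else if m = 3 then 0 else of_bool (in_S m p q \<and> \<not> in_S 0 p q))"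
| "elem_coeff Shape2 m p q =
     (if m = 0 then 0 else if m = 3 then of_bool (\<not> in_S 0 p q) else - of_bool (\<not> in_S m p q))"
| "elem_coeff (Shape3 i k) m p q = (if m = k then - of_bool (\<not> in_S k p q) else 0)"
| "elem_coeff (Shape4 i) m p q =
     (if m = i then - of_bool (\<not> in_S i p q)
      else if m = 3 then of_bool (in_S 3 p q \<and> \<not> in_S i p q) else 0)"
| "elem_coeff Shape5 m p q = (if m = 3 then - of_bool (\<not> in_S 3 p q) else 0)"

text \<open>A pair \<open>(a, b)\<close> stands for \<open>a + b * c\<close>, where \<open>c\<close> is \<open>u\<close> for a C-family and \<open>l\<close> for a D-family.\<close>

fun const_coeff :: "shape \<Rightarrow> nat \<Rightarrow> int \<times> int" where
  "const_coeff Shape1 m = (if m = 0 then (0, 1) else (0, 0))"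
| "const_coeff Shape2 m = (if m = 0 then (0, 0) else if m = 3 then (0, -1) else (0, 1))"
| "const_coeff (Shape3 i k) m =
     (if m = i then (-1, 0) else if m = k then (-1, 1) else (1, 0))"
| "const_coeff (Shape4 i) m = (if m = i then (0, 1) else (0, 0))"
| "const_coeff Shape5 m = (if m = 3 then (0, 1) else (0, 0))"

section \<open>Admissibility and excess in terms of the set \<open>P\<close>\<close>

context setting
begin

definition elem_weight :: "(nat \<Rightarrow> rat) \<Rightarrow> ('a \<Rightarrow> rat) \<Rightarrow> shape \<Rightarrow> 'a \<Rightarrow> rat" where
  "elem_weight \<delta> z sh j = z j + (\<Sum>m<4. of_int (elem_coeff sh m (j \<in> S1) (j \<in> S2)) * \<delta> m)"

definition const_term :: "(nat \<Rightarrow> rat) \<Rightarrow> shape \<Rightarrow> int \<Rightarrow> rat" where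
  "const_term \<delta> sh c =
     (\<Sum>m<4. of_int (fst (const_coeff sh m) + snd (const_coeff sh m) * c) * \<delta> m)"

definition bound :: "bool \<Rightarrow> int" where
  "bound d = (if d then l else u)"

definition choice_set :: "bool \<Rightarrow> 'a set \<Rightarrow> 'a set" where
  "choice_set d Q = (if d then J - Q else Q)"

lemma sum_lessThan_4: "(\<Sum>m<4. f m) = f 0 + f 1 + f 2 + f (3::nat)"
  for f :: "nat \<Rightarrow> 'b::comm_monoid_add"
  by (simp add: eval_nat_numeral algebra_simps)

lemma S_eq: "S i = {j. in_S i (j \<in> S1) (j \<in> S2)}"
  by (auto simp: S_def in_S_def)

lemma S_subset_J: "S i \<subseteq> J"
  using S1_subset S2_subset by (auto simp: S_def)

lemma finite_choice_set: "Q \<subseteq> J \<Longrightarrow> finite (choice_set d Q)"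
  using finite_J finite_subset by (auto simp: choice_set_def)

text \<open>It converts the coefficient l + |Q union S_i| - n of a D-family into l - |P - S_i|, the
  counterpart of u - |Q - S_i| in the C-family.\<close>

lemma card_union_S:
  assumes "Q \<subseteq> J"
  shows "int (card (Q \<union> S i)) = n - int (card ((J - Q) - S i))"
proof -
  have "(J - Q) - S i = J - (Q \<union> S i)" by blast
  then have "card ((J - Q) - S i) = card J - card (Q \<union> S i)"
    using assms S_subset_J[of i] finite_J finite_subset[of "Q \<union> S i" J]
    by (simp add: card_Diff_subset)
  moreover have "card (Q \<union> S i) \<le> card J"
    using assms S_subset_J[of i] finite_J by (intro card_mono) auto
  ultimately show ?thesis by (simp add: n_def)
qed

lemma admissible_ineq_of:
  assumes "sh \<in> shapes"
  shows "admissible (ineq_of sh d Q) \<longleftrightarrow>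
    Q \<subseteq> J \<and> int (card {j \<in> choice_set d Q. capped sh (j \<in> S1) (j \<in> S2)}) \<le> cap sh (bound d)"
proof (cases "Q \<subseteq> J")
  case False
  then show ?thesis using assms by (cases d) (auto simp: shapes_def)
next
  case True
  define P where "P = choice_set d Q"
  have outside: "{j \<in> P. \<not> in_S i (j \<in> S1) (j \<in> S2)} = P - S i" for i
    by (auto simp: S_eq)
  have "{j \<in> P. in_S i (j \<in> S1) (j \<in> S2) \<and> \<not> in_S 0 (j \<in> S1) (j \<in> S2)} = P \<inter> (S i - S 0)" for i
    by (auto simp: S_eq)
  then have inside: "int (card {j \<in> P. in_S i (j \<in> S1) (j \<in> S2) \<and> \<not> in_S 0 (j \<in> S1) (j \<in> S2)}) \<le> 0
      \<longleftrightarrow> P \<inter> (S i - S 0) = {}" for i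
    using finite_choice_set[OF True, of d] by (simp add: P_def)
  have swap: "{2, Suc 0} = {Suc 0, 2}" by blast
  show ?thesis
  proof (cases d)
    case d: True
    have un: "int (card (Q \<union> S i)) = n - int (card (P - S i))" for i
      using card_union_S[OF True] d by (simp add: P_def choice_set_def)
    have empty: "S i - S 0 \<subseteq> Q \<longleftrightarrow> P \<inter> (S i - S 0) = {}" for i
      using S_subset_J[of i] d by (auto simp: P_def choice_set_def)
    show ?thesis
      using assms l_nonneg d True unfolding shapes_def P_def[symmetric]
      by (elim insertE emptyE)
        (simp_all add: outside bound_def un empty inside swap del: of_nat_le_0_iff)
  next
    case d: False
    then have PQ: "P = Q" by (simp add: P_def choice_set_def)
    show ?thesis
      using assms u_ge_2 d True unfolding shapes_def P_def[symmetric] unfolding PQ[symmetric]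
      by (elim insertE emptyE)
        (simp_all add: outside bound_def inside swap del: of_nat_le_0_iff)
  qed
qed

text \<open>For a D-family the sum over \<open>J\<close> enters because the negated sum over
  \<open>Q\<close> is the sum over \<open>P\<close> minus the sum over \<open>J\<close>.\<close>

lemma lhs_ineq_of:
  assumes "sh \<in> shapes" "Q \<subseteq> J"
  shows "lhs \<delta> z (ineq_of sh d Q) - rhs (ineq_of sh d Q) =
    const_term \<delta> sh (bound d) + (\<Sum>j\<in>choice_set d Q. elem_weight \<delta> z sh j)
      - (if d then (\<Sum>j\<in>J. z j) else of_int u)"
proof -
  define P where "P = choice_set d Q"
  have fin: "finite P" using finite_choice_set[OF assms(2)] by (simp add: P_def)
  \<comment> \<open>Written as sums of indicators, all cardinalities become expressions in the same
    quantities, and both sides can be compared by linear algebra.\<close>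
  define N where "N X = (\<Sum>j\<in>P. of_bool (X (j \<in> S1) (j \<in> S2)) :: rat)" for X
  have N: "of_nat (card {j \<in> P. X (j \<in> S1) (j \<in> S2)}) = N X" for X
    using fin by (simp add: N_def Int_def conj_commute)
  have out: "of_nat (card (P - S i)) = N (\<lambda>p q. \<not> in_S i p q)" for i
    unfolding N[symmetric] by (rule arg_cong[of _ _ "\<lambda>A. of_nat (card A)"]) (auto simp: S_eq)
  have ins: "of_nat (card (P \<inter> S i - S k)) = N (\<lambda>p q. in_S i p q \<and> \<not> in_S k p q)" for i k
    unfolding N[symmetric] by (rule arg_cong[of _ _ "\<lambda>A. of_nat (card A)"]) (auto simp: S_eq)
  have weight: "(\<Sum>j\<in>P. elem_weight \<delta> z sh j) = (\<Sum>j\<in>P. z j)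
      + (\<Sum>m<4. (\<Sum>j\<in>P. of_int (elem_coeff sh m (j \<in> S1) (j \<in> S2))) * \<delta> m)"
    unfolding elem_weight_def sum.distrib by (subst sum.swap) (simp add: sum_distrib_right)
  show ?thesis
  proof (cases d)
    case d: False
    then have PQ: "P = Q" by (simp add: P_def choice_set_def)
    show ?thesis
      using assms(1) d
      unfolding P_def[symmetric] weight const_term_def sum_lessThan_4 shapes_def
      unfolding PQ[symmetric]
      by (elim insertE emptyE)
        (simp_all add: rhs_def out ins bound_def sum_negf N_def algebra_simps)
  next
    case d: True
    then have PQ: "P = J - Q" by (simp add: P_def choice_set_def)
    have un: "int (card (Q \<union> S i)) = n - int (card (P - S i))" for i
      using card_union_S[OF assms(2)] PQ by simp
    have dif: "S i - (S k \<union> Q) = P \<inter> S i - S k" for i k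
      using S_subset_J[of i] by (auto simp: PQ)
    have z: "(\<Sum>j\<in>J. z j) = (\<Sum>j\<in>P. z j) + (\<Sum>j\<in>Q. z j)"
      unfolding PQ using assms(2) finite_J by (simp add: sum.subset_diff)
    show ?thesis
      using assms(1) d
      unfolding P_def[symmetric] weight const_term_def sum_lessThan_4 shapes_def
      by (elim insertE emptyE)
        (simp_all add: rhs_def un dif z out ins bound_def sum_negf N_def algebra_simps)
  qed
qed

text \<open>Admissibility restricts the indices to 1 and 2, so seven shapes with a flag reach every
  competitor. Optimality and separation are both reduced to shapes through this.\<close>

lemma admissible_cases:
  assumes "admissible q"
  obtains sh d Q where "sh \<in> shapes" "Q \<subseteq> J" "q = ineq_of sh d Q"
proof -
  have pair: "(i = 1 \<and> k = 2) \<or> (i = 2 \<and> k = 1)" if "{i, k} = {1, 2}" for i k :: nat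
    using that by (auto simp: doubleton_eq_iff)
  show ?thesis
  proof (cases q)
    case (C1 Q) then show ?thesis using assms that[of Shape1 Q False] by (simp add: shapes_def)
  next
    case (C2 Q) then show ?thesis using assms that[of Shape2 Q False] by (simp add: shapes_def)
  next
    case (C3 i k Q) then show ?thesis
      using assms that[of "Shape3 i k" Q False] pair[of i k] by (auto simp: shapes_def)
  next
    case (C4 i Q) then show ?thesis
      using assms that[of "Shape4 i" Q False] by (auto simp: shapes_def)
  next
    case (C5 Q) then show ?thesis using assms that[of Shape5 Q False] by (simp add: shapes_def)
  next
    case (D1 Q) then show ?thesis using assms that[of Shape1 Q True] by (simp add: shapes_def)
  next
    case (D2 Q) then show ?thesis using assms that[of Shape2 Q True] by (simp add: shapes_def)
  next
    case (D3 i k Q) then show ?thesis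
      using assms that[of "Shape3 i k" Q True] pair[of i k] by (auto simp: shapes_def)
  next
    case (D4 i Q) then show ?thesis
      using assms that[of "Shape4 i" Q True] by (auto simp: shapes_def)
  next
    case (D5 Q) then show ?thesis using assms that[of Shape5 Q True] by (simp add: shapes_def)
  qed
qed

end

section \<open>The programs\<close>

text \<open>
  Cells 0 to 2 hold \<open>n\<close>, \<open>l\<close>, \<open>u\<close>; numerator and denominator of \<open>\<delta> i\<close> are in cells \<open>3 + 2 * i\<close> and
  \<open>4 + 2 * i\<close>; the four entries of the element with index \<open>j\<close> start at cell \<open>11 + 4 * j\<close>.
  Registers: 0 and 2 are the outer and inner loop indices, 3 is a rank, 4 tells whether the current
  element is chosen, 5 and 6 are numerator and denominator of the objective value, 7 and 8 save them.
\<close>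

definition entry :: "int \<Rightarrow> nat \<Rightarrow> expr" where
  "entry m r = Mem (Plus (Const (11 + m)) (Times (Const 4) (Reg r)))"

text \<open>Expressions have no conditional, so \<open>f\<close> is interpolated by the polynomial
  that is linear in each of the two membership bits.\<close>

definition table :: "(bool \<Rightarrow> bool \<Rightarrow> int) \<Rightarrow> nat \<Rightarrow> expr" where
  "table f r =
     (let p = entry 0 r; q = entry 1 r; p' = Minus (Const 1) p; q' = Minus (Const 1) q in
      Plus (Plus (Times (Const (f True True)) (Times p q))
                 (Times (Const (f True False)) (Times p q')))
           (Plus (Times (Const (f False True)) (Times p' q))
                 (Times (Const (f False False)) (Times p' q'))))"

definition sum4 :: "(nat \<Rightarrow> expr) \<Rightarrow> expr" where
  "sum4 f = Plus (Plus (f 0) (f 1)) (Plus (f 2) (f 3))"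

text \<open>The numerator of \<open>\<delta> m\<close> over the common denominator, which itself is the case \<open>m = 4\<close>.\<close>

definition delta_prod :: "nat \<Rightarrow> expr" where
  "delta_prod m =
     (let f = \<lambda>i. Mem (Const ((if i = m then 3 else 4) + 2 * int i))
      in Times (Times (f 0) (f 1)) (Times (f 2) (f 3)))"

definition denom :: expr where
  "denom = delta_prod 4"

text \<open>The weight multiplied by the denominator of \<open>z j\<close> and by the common denominator of \<open>\<delta>\<close>.\<close>

definition weight_expr :: "shape \<Rightarrow> nat \<Rightarrow> expr" where
  "weight_expr sh r =
     Plus (Times (entry 2 r) denom)
       (Times (entry 3 r) (sum4 (\<lambda>m. Times (table (elem_coeff sh m) r) (delta_prod m))))"

definition capped_expr :: "shape \<Rightarrow> nat \<Rightarrow> expr" where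
  "capped_expr sh r = table (\<lambda>p q. of_bool (capped sh p q)) r"

definition bound_expr :: "bool \<Rightarrow> expr" where
  "bound_expr d = Mem (Const (if d then 1 else 2))"

fun cap_expr :: "shape \<Rightarrow> bool \<Rightarrow> expr" where
  "cap_expr (Shape3 i k) d = Const 0"
| "cap_expr _ d = bound_expr d"

text \<open>Since \<open>\<bar>j - k\<bar> < n + 1\<close>, the factor \<open>n + 1\<close> turns the lexicographic comparison into one sign test.\<close>

definition beats_expr :: "shape \<Rightarrow> expr" where
  "beats_expr sh =
     Times (capped_expr sh 2)
       (Plus (Times (Minus (Times (weight_expr sh 2) (entry 3 0))
                           (Times (weight_expr sh 0) (entry 3 2)))
                    (Plus (Mem (Const 0)) (Const 1)))
             (Minus (Reg 0) (Reg 2)))"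

definition rank_prog :: "shape \<Rightarrow> prog" where
  "rank_prog sh = Seq (Assign 3 (Const 0))
     (For 2 (IfPos (beats_expr sh) (Assign 3 (Plus (Reg 3) (Const 1))) Skip))"

text \<open>For integers, \<open>rank + 1 - cap > 0\<close> means \<open>rank >= cap\<close>;
  multiplied by the 0/1 flag, it is positive exactly for a capped element that finds no free
  slot.\<close>

definition choose_prog :: "shape \<Rightarrow> bool \<Rightarrow> prog" where
  "choose_prog sh d = Seq (rank_prog sh)
     (IfPos (weight_expr sh 0)
        (IfPos (Times (capped_expr sh 0) (Minus (Plus (Reg 3) (Const 1)) (cap_expr sh d)))
           (Assign 4 (Const 0)) (Assign 4 (Const 1)))
        (Assign 4 (Const 0)))"

text \<open>In a D-family the negated sum of \<open>z\<close> over \<open>J\<close> is left out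
  here, as its denominators are not part of \<open>denom\<close>; \<open>term_expr\<close> subtracts
  it element by element.\<close>

definition init_expr :: "shape \<Rightarrow> bool \<Rightarrow> expr" where
  "init_expr sh d = Minus
     (sum4 (\<lambda>m. Times (Plus (Const (fst (const_coeff sh m)))
                            (Times (Const (snd (const_coeff sh m))) (bound_expr d)))
                      (delta_prod m)))
     (if d then Const 0 else Times (bound_expr d) denom)"

definition term_expr :: "shape \<Rightarrow> bool \<Rightarrow> expr" where
  "term_expr sh d = Minus (Times (Reg 4) (weight_expr sh 0))
     (if d then Times (entry 2 0) denom else Const 0)"

definition scale_expr :: expr where
  "scale_expr = Times (entry 3 0) denom"

text \<open>Registers 5 and 6 add fractions by a/b + t/s = (a s + t b)/(b s) without reduction, so
  register 5 must be updated while register 6 still holds the old denominator.\<close>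

definition eval_prog :: "shape \<Rightarrow> bool \<Rightarrow> prog" where
  "eval_prog sh d = Seq (Assign 5 (init_expr sh d)) (Seq (Assign 6 denom)
     (For 0 (Seq (choose_prog sh d)
       (Seq (Assign 5 (Plus (Times (Reg 5) scale_expr) (Times (term_expr sh d) (Reg 6))))
            (Assign 6 (Times (Reg 6) scale_expr))))))"

fun header :: "shape \<Rightarrow> bool \<Rightarrow> int list" where
  "header Shape1 d = [if d then 6 else 1]"
| "header Shape2 d = [if d then 7 else 2]"
| "header (Shape3 i k) d = [if d then 8 else 3, int i, int k]"
| "header (Shape4 i) d = [if d then 9 else 4, int i]"
| "header Shape5 d = [if d then 10 else 5]"

lemma encode_ineq_of: "encode_ineq js (ineq_of sh d Q) = header sh d @ encode_set js Q"
  by (cases sh) auto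

definition write_list :: "int list \<Rightarrow> prog" where
  "write_list ys = foldr (\<lambda>y. Seq (Write (Const y))) ys Skip"

lemma wp_write_list:
  "bounded B s \<Longrightarrow> Q (s\<lparr>out := out s @ ys\<rparr>) \<Longrightarrow> wp N B (write_list ys) Q s"
proof (induction ys arbitrary: s)
  case (Cons y ys)
  have "wp N B (write_list ys) Q (s\<lparr>out := out s @ [y]\<rparr>)"
    using Cons.prems by (intro Cons.IH) simp_all
  then show ?case
    using Cons.prems(1) by (simp add: write_list_def) (intro wp_Seq wp_Write, simp_all)
qed (auto simp: write_list_def intro: wp_Skip)

definition output_prog :: "shape \<Rightarrow> bool \<Rightarrow> prog" where
  "output_prog sh d = Seq (write_list (header sh d))
     (For 0 (Seq (choose_prog sh d) (Write (if d then Minus (Const 1) (Reg 4) else Reg 4))))"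

lemma nth_concat_map_4:
  assumes "\<And>x. length (f x) = 4" "m < 4" "j < length ys"
  shows "concat (map f ys) ! (4 * j + m) = f (ys ! j) ! m"
  using assms(3)
proof (induction ys arbitrary: j)
  case (Cons y ys)
  then show ?case using assms(1,2) by (cases j) (auto simp: nth_append)
qed simp

section \<open>Values of the expressions on an encoded instance\<close>

locale problem = setting J S1 S2 l u for J S1 S2 :: "'a set" and l u :: int +
  fixes js :: "'a list" and \<delta> :: "nat \<Rightarrow> rat" and z :: "'a \<Rightarrow> rat"
  assumes distinct_js: "distinct js" and set_js: "set js = J"
begin

definition input_list :: "int list" where
  "input_list = encode_input (J, S1, S2, l, u, js, \<delta>, z)"

definition M :: "int \<Rightarrow> int" where
  "M = mem (init_state input_list)"

definition L :: nat where
  "L = input_size input_list"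

definition D :: int where
  "D = (\<Prod>i<4. snd (quotient_of (\<delta> i)))"

definition b :: "nat \<Rightarrow> int" where
  "b j = snd (quotient_of (z (js ! j)))"

definition w :: "shape \<Rightarrow> nat \<Rightarrow> rat" where
  "w sh j = elem_weight \<delta> z sh (js ! j)"

definition U :: "shape \<Rightarrow> nat set" where
  "U sh = {j. capped sh (js ! j \<in> S1) (js ! j \<in> S2)}"

text \<open>The greedy choice works on list positions because breaking ties needs a linear order,
  which \<open>'a\<close> need not have.\<close>

definition chosen :: "shape \<Rightarrow> bool \<Rightarrow> nat set" where
  "chosen sh d = greedy (w sh) {..<length js} (U sh) (nat (cap sh (bound d)))"

lemma M_header:
  "M 0 = int (length js)" "M 1 = l" "M 2 = u"
  "M 3 = fst (quotient_of (\<delta> 0))" "M 4 = snd (quotient_of (\<delta> 0))"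
  "M 5 = fst (quotient_of (\<delta> 1))" "M 6 = snd (quotient_of (\<delta> 1))"
  "M 7 = fst (quotient_of (\<delta> 2))" "M 8 = snd (quotient_of (\<delta> 2))"
  "M 9 = fst (quotient_of (\<delta> 3))" "M 10 = snd (quotient_of (\<delta> 3))"
  by (auto simp: M_def init_state_def input_list_def encode_rat_def)

lemma M_entry:
  assumes "j < length js"
  shows "M (11 + 4 * int j) = of_bool (js ! j \<in> S1)"
    "M (12 + 4 * int j) = of_bool (js ! j \<in> S2)"
    "M (13 + 4 * int j) = fst (quotient_of (z (js ! j)))"
    "M (14 + 4 * int j) = b j"
proof -
  let ?f = "\<lambda>j. [of_bool (j \<in> S1), of_bool (j \<in> S2)] @ encode_rat (z j)"
  have len: "length (?f x) = 4" for x by (simp add: encode_rat_def)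
  have tl: "length (concat (map ?f js)) = 4 * length js"
    by (induction js) (auto simp: encode_rat_def)
  have "M (int (11 + (4 * j + m))) = ?f (js ! j) ! m" if "m < 4" for m
  proof -
    define hd where
      "hd = [int (length js), l, u] @ concat (map (\<lambda>i. encode_rat (\<delta> i)) [0, 1, 2, 3])"
    have hd: "input_list = hd @ concat (map ?f js)" "length hd = 11"
      by (simp_all add: input_list_def hd_def encode_rat_def)
    have "length input_list = 11 + 4 * length js"
      unfolding hd(1) length_append hd(2) tl ..
    then have "11 + (4 * j + m) < length input_list"
      using assms that by simp
    then have "M (int (11 + (4 * j + m))) = input_list ! (11 + (4 * j + m))"
      unfolding M_def init_state_def by (simp only: nat_int of_nat_0_le_iff of_nat_less_iff
          state.simps simp_thms if_True)
    also have "\<dots> = concat (map ?f js) ! (4 * j + m)"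
      unfolding hd(1) hd(2)[symmetric] by (rule nth_append_length_plus)
    also have "\<dots> = ?f (js ! j) ! m"
      by (rule nth_concat_map_4[OF len that assms])
    finally show ?thesis .
  qed
  from this[of 0] this[of 1] this[of 2] this[of 3]
  show "M (11 + 4 * int j) = of_bool (js ! j \<in> S1)"
    "M (12 + 4 * int j) = of_bool (js ! j \<in> S2)"
    "M (13 + 4 * int j) = fst (quotient_of (z (js ! j)))"
    "M (14 + 4 * int j) = b j"
    by (simp_all add: encode_rat_def b_def add.commute add.left_commute)
qed

lemma quotient_of_eq: "of_int (fst (quotient_of r)) = r * of_int (snd (quotient_of r))" for r :: rat
  using quotient_of_div[of r "fst (quotient_of r)" "snd (quotient_of r)"]
    quotient_of_denom_pos'[of r] by (simp add: field_simps)

lemma b_pos: "0 < b j"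
  by (simp add: b_def quotient_of_denom_pos')

lemma D_pos: "0 < D"
  unfolding D_def by (intro prod_pos) (simp add: quotient_of_denom_pos')

text \<open>Every entry has size at least 1, so the input size can also serve as the bound on loop
  counts.\<close>

lemma length_le_L: "length js \<le> L"
proof -
  have "length ys \<le> input_size ys" for ys
  proof (induction ys)
    case (Cons y ys)
    then show ?case using bit_size_ge_1[of y] by (simp add: input_size_def)
  qed simp
  moreover have "length js \<le> length (concat (map (\<lambda>j. [of_bool (j \<in> S1), of_bool (j \<in> S2)] @ encode_rat (z j)) xs))"
    if "xs = js" for xs
    unfolding that[symmetric] by (induction xs) auto
  then have "length js \<le> length input_list"
    unfolding input_list_def encode_input.simps length_append by (simp add: trans_le_add2)
  ultimately show ?thesis
    unfolding L_def by (rule le_trans[rotated])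
qed

lemma length_ge_2: "2 \<le> length js"
proof -
  have "length js = card J" using distinct_card[OF distinct_js] set_js by simp
  moreover have "card S1 \<le> card J" using S1_subset finite_J by (rule card_mono[rotated])
  ultimately show ?thesis using card_S1(1) by simp
qed

lemma bit_size_M: "bit_size (M a) \<le> L"
proof (cases "0 \<le> a \<and> a < int (length input_list)")
  case True
  then have "bit_size (input_list ! nat a) \<le> sum_list (map bit_size input_list)"
    by (intro member_le_sum_list) auto
  then show ?thesis using True by (simp add: M_def init_state_def L_def input_size_def)
next
  case False
  then have "M a = 0" by (auto simp: M_def init_state_def)
  then show ?thesis
    using length_ge_2 length_le_L by (simp add: bit_size_def floorlog_def)
qed

text \<open>The number \<open>n\<close> is itself an input cell, so loop indices and ranks are no
  longer than the input.\<close>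

lemma bit_size_index: "i \<le> length js \<Longrightarrow> bit_size (int i) \<le> L"
  using bit_size_M[of 0] bit_size_mono[of "int i" "M 0"] by (simp add: M_header)

lemma bit_size_0_1: "bit_size 0 \<le> L" "bit_size 1 \<le> L"
  using bit_size_index[of 0] bit_size_index[of 1] length_ge_2 by simp_all

definition ok :: "nat \<Rightarrow> state \<Rightarrow> bool" where
  "ok B s \<longleftrightarrow> mem s = M \<and> bounded B s"

lemma ok_regs_upd: "ok B s \<Longrightarrow> bit_size v \<le> B \<Longrightarrow> ok B (s\<lparr>regs := (regs s)(r := v)\<rparr>)"
  by (simp add: ok_def bounded_regs_upd)

lemma val_delta_prod:
  assumes "mem s = M"
  shows "val denom s = D"
    "m < 4 \<Longrightarrow> of_int (val (delta_prod m) s) = \<delta> m * (of_int D :: rat)"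
proof -
  have D: "D = M 4 * M 6 * M 8 * M 10"
    by (simp add: D_def M_header eval_nat_numeral algebra_simps)
  show "val denom s = D"
    using assms by (simp add: denom_def delta_prod_def Let_def D)
  assume "m < 4"
  then consider "m = 0" | "m = 1" | "m = 2" | "m = 3" by linarith
  then show "of_int (val (delta_prod m) s) = \<delta> m * (of_int D :: rat)"
    by cases (simp_all add: assms delta_prod_def Let_def D M_header quotient_of_eq)
qed

context
  fixes s :: state and r j :: nat
  assumes s: "mem s = M" "regs s r = int j" "j < length js"
begin

lemma val_entry_simps:
  "val (entry 0 r) s = of_bool (js ! j \<in> S1)"
  "val (entry 1 r) s = of_bool (js ! j \<in> S2)"
  "of_int (val (entry 2 r) s) = z (js ! j) * of_int (b j)"
  "val (entry 3 r) s = b j"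
  using s M_entry[of j] by (simp_all add: entry_def quotient_of_eq b_def)

lemma val_table: "val (table f r) s = f (js ! j \<in> S1) (js ! j \<in> S2)"
  by (simp add: table_def Let_def val_entry_simps)

lemma val_weight_expr: "of_int (val (weight_expr sh r) s) = w sh j * (of_int (b j) * of_int D)"
  using s
  by (simp add: weight_expr_def sum4_def val_table val_entry_simps val_delta_prod w_def
      elem_weight_def sum_lessThan_4 algebra_simps)

lemma val_capped_expr: "val (capped_expr sh r) s = of_bool (j \<in> U sh)"
  by (simp add: capped_expr_def val_table U_def)

lemma weight_expr_pos_iff: "0 < val (weight_expr sh r) s \<longleftrightarrow> 0 < w sh j"
proof -
  have "0 < val (weight_expr sh r) s \<longleftrightarrow> 0 < w sh j * (of_int (b j) * of_int D)"
    by (simp flip: val_weight_expr)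
  moreover have "0 < (of_int (b j) * of_int D :: rat)"
    using b_pos[of j] D_pos by simp
  ultimately show ?thesis
    by (metis zero_less_mult_pos2 mult_pos_pos)
qed

end

lemma val_bound_expr: "mem s = M \<Longrightarrow> val (bound_expr d) s = bound d"
  by (simp add: bound_expr_def bound_def M_header)

lemma val_cap_expr: "mem s = M \<Longrightarrow> val (cap_expr sh d) s = cap sh (bound d)"
  by (cases sh) (auto simp: val_bound_expr)

lemma beats_expr_pos_iff:
  assumes s: "mem s = M" "regs s 0 = int j" "j < length js" "regs s 2 = int k" "k < length js"
  shows "0 < val (beats_expr sh) s \<longleftrightarrow> k \<in> U sh \<and> beats (w sh) k j"
proof -
  define x where "x = val (weight_expr sh 2) s * b j - val (weight_expr sh 0) s * b k"
  \<comment> \<open>Both weights already carry the factor \<open>D\<close>, so only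
    \<open>b j\<close> and \<open>b k\<close> are cross-multiplied; \<open>y\<close> is the common
    positive factor that results.\<close>
  define y :: rat where "y = of_int (b j) * of_int (b k) * of_int D"
  have xy: "of_int x = (w sh k - w sh j) * y"
    using val_weight_expr[OF s(1,2,3), of sh] val_weight_expr[OF s(1,4,5), of sh]
    by (simp add: x_def y_def algebra_simps)
  have y: "0 < y"
    using b_pos[of j] b_pos[of k] D_pos by (simp add: y_def)
  have "0 < (of_int x :: rat) \<longleftrightarrow> w sh j < w sh k" "of_int x = (0 :: rat) \<longleftrightarrow> w sh k = w sh j"
    unfolding xy using y by (auto simp: zero_less_mult_iff)
  then have x: "0 < x \<longleftrightarrow> w sh j < w sh k" "x = 0 \<longleftrightarrow> w sh k = w sh j"
    by simp_all
  have ints: "0 \<le> int j" "int j < int (length js)" "0 \<le> int k" "int k < int (length js)"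
    using s(3,5) by simp_all
  define X where "X = x * (int (length js) + 1)"
  have "0 < X + (int j - int k) \<longleftrightarrow> 0 < x \<or> (x = 0 \<and> k < j)"
  proof -
    \<comment> \<open>A nonzero integer \<open>x\<close> has absolute value at least 1, so
      \<open>X\<close> outweighs \<open>int j - int k\<close>.\<close>
    consider "x = 0" | "1 \<le> x" | "x \<le> -1" by linarith
    then show ?thesis
    proof cases
      case 2
      then have "1 * (int (length js) + 1) \<le> X"
        unfolding X_def by (intro mult_right_mono) auto
      then have "0 < X + (int j - int k)" using ints by simp
      then show ?thesis using 2 by simp
    next
      case 3
      then have "X \<le> (-1) * (int (length js) + 1)"
        unfolding X_def by (intro mult_right_mono) auto
      then have "\<not> 0 < X + (int j - int k)" using ints by simp
      then show ?thesis using 3 by simp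
    qed (simp add: X_def)
  qed
  moreover have "val (beats_expr sh) s =
      of_bool (k \<in> U sh) * (X + (int j - int k))"
    using s by (simp add: beats_expr_def X_def x_def M_header val_capped_expr[OF s(1,4,5)]
        val_entry_simps[OF s(1,2,3)] val_entry_simps[OF s(1,4,5)])
  ultimately show ?thesis using x by (auto simp: beats_def)
qed

end

section \<open>Running the programs\<close>

lemma expr_regs_simps [simp]:
  "expr_regs (entry i r) = {r}" "expr_regs (table g r) = {r}" "expr_regs (delta_prod m) = {}"
  "expr_regs denom = {}" "expr_regs (sum4 f) = expr_regs (f 0) \<union> expr_regs (f 1) \<union> expr_regs (f 2) \<union> expr_regs (f 3)"
  "expr_regs (weight_expr sh r) = {r}" "expr_regs (bound_expr d) = {}"
  "expr_regs (init_expr sh d) = {}" "expr_regs scale_expr = {0}"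
  by (auto simp: entry_def table_def Let_def delta_prod_def denom_def sum4_def weight_expr_def
      bound_expr_def init_expr_def scale_expr_def)

lemma expr_regs_term_expr: "expr_regs (term_expr sh d) = {0, 4}"
  by (auto simp: term_expr_def)

text \<open>One iteration of \<open>eval_prog\<close> lengthens numerator and denominator by at most \<open>growth sh d * L\<close> bits.\<close>

definition growth :: "shape \<Rightarrow> bool \<Rightarrow> nat" where
  "growth sh d = expr_factor (init_expr sh d) + expr_factor denom + expr_factor scale_expr
     + expr_factor (term_expr sh d) + 1"

text \<open>With K = \<open>growth sh d\<close>, the fraction starts with at most K x bits and gains
  at most K x in each of at most x iterations.\<close>

definition bit_bound :: "shape \<Rightarrow> bool \<Rightarrow> nat \<Rightarrow> nat" where
  "bit_bound sh d x = growth sh d * x * (x + 1)"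

context problem
begin

lemma ok_bounded: "ok B s \<Longrightarrow> bounded B s"
  by (simp add: ok_def)

lemma ok_mem: "ok B s \<Longrightarrow> mem s = M"
  by (simp add: ok_def)

lemma ok_out_upd [simp]: "ok B (s\<lparr>out := ys\<rparr>) = ok B s"
  by (simp add: ok_def)

definition rank :: "shape \<Rightarrow> nat \<Rightarrow> nat \<Rightarrow> nat" where
  "rank sh j i = card {k. k < i \<and> k \<in> U sh \<and> beats (w sh) k j}"

lemma rank_0: "rank sh j 0 = 0"
  by (simp add: rank_def)

lemma rank_Suc: "rank sh j (Suc i) = rank sh j i + of_bool (i \<in> U sh \<and> beats (w sh) i j)"
proof (cases "i \<in> U sh \<and> beats (w sh) i j")
  case True
  then have "{k. k < Suc i \<and> k \<in> U sh \<and> beats (w sh) k j}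
      = insert i {k. k < i \<and> k \<in> U sh \<and> beats (w sh) k j}"
    by (auto simp: less_Suc_eq)
  then show ?thesis using True by (simp add: rank_def)
next
  case False
  then have "{k. k < Suc i \<and> k \<in> U sh \<and> beats (w sh) k j}
      = {k. k < i \<and> k \<in> U sh \<and> beats (w sh) k j}"
    by (auto simp: less_Suc_eq)
  then show ?thesis using False by (simp add: rank_def)
qed

lemma rank_le: "rank sh j i \<le> i"
  by (induction i) (auto simp: rank_0 rank_Suc)

text \<open>A frame condition: \<open>X\<close> lists the registers that may change. The memory is
  left to \<open>ok\<close>, which fixes it to the input.\<close>

definition same_regs :: "nat set \<Rightarrow> state \<Rightarrow> state \<Rightarrow> bool" where
  "same_regs X s s' \<longleftrightarrow> out s' = out s \<and> (\<forall>r. r \<notin> X \<longrightarrow> regs s' r = regs s r)"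

lemma wp_rank_prog:
  assumes s: "ok B s" "regs s 0 = int j" and j: "j < length js" and B: "L \<le> B"
  shows "wp L B (rank_prog sh)
    (\<lambda>s'. ok B s' \<and> same_regs {2, 3} s s' \<and> regs s' 3 = int (rank sh j (length js))) s"
  unfolding rank_prog_def
proof (intro wp_Seq wp_Assign)
  show "bounded B s" using s by (simp add: ok_def)
  let ?I = "\<lambda>i s'. ok B s' \<and> same_regs {2, 3} s s' \<and> regs s' 3 = int (rank sh j i)"
  let ?s = "s\<lparr>regs := (regs s)(3 := val (Const 0) s)\<rparr>"
  have small: "bit_size (int i) \<le> B" if "i \<le> length js" for i
    using bit_size_index[OF that] B by simp
  have zero: "bit_size 0 \<le> B" using small[of 0] by simp
  show "wp L B (For 2 (IfPos (beats_expr sh) (Assign 3 (Plus (Reg 3) (Const 1))) Skip))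
      (?I (length js)) ?s"
  proof (rule wp_For[where Inv = ?I and m = "length js"])
    show "bounded B ?s"
      using s zero by (auto simp: ok_def bounded_def)
    show "?I 0 (?s\<lparr>regs := (regs ?s)(2 := 0)\<rparr>)"
      using s zero by (auto simp: ok_def bounded_def rank_0 same_regs_def)
    show "length js \<le> L" by (rule length_le_L)
  next
    fix i s' assume "?I i s'"
    then show "bounded B s' \<and> mem s' 0 = int (length js)"
      by (simp add: ok_def M_header)
  next
    fix i s' assume i: "i < length js" and I: "?I i s'" and r2: "regs s' 2 = int i"
    have r0: "regs s' 0 = int j" using I s(2) by (simp add: same_regs_def)
    have pos: "0 < val (beats_expr sh) s' \<longleftrightarrow> i \<in> U sh \<and> beats (w sh) i j"
      using I by (intro beats_expr_pos_iff r0 j r2 i) (simp add: ok_def)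
    have bd: "bounded B s'" using I by (simp add: ok_def)
    have le: "rank sh j (Suc i) \<le> length js" using rank_le[of sh j "Suc i"] i by simp
    have Suc_i: "bit_size (int (Suc i)) \<le> B" using i by (intro small) simp
    show "wp L B (IfPos (beats_expr sh) (Assign 3 (Plus (Reg 3) (Const 1))) Skip)
        (\<lambda>s'. bounded B s' \<and> regs s' 2 = int i
          \<and> ?I (Suc i) (s'\<lparr>regs := (regs s')(2 := int (Suc i))\<rparr>)) s'"
    proof (rule wp_IfPos[OF bd])
      assume "0 < val (beats_expr sh) s'"
      then have val: "val (Plus (Reg 3) (Const 1)) s' = int (rank sh j (Suc i))"
        using I pos by (simp add: rank_Suc)
      let ?t = "s'\<lparr>regs := (regs s')(3 := int (rank sh j (Suc i)))\<rparr>"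
      have t: "ok B ?t" using I by (intro ok_regs_upd small le) simp
      show "wp L B (Assign 3 (Plus (Reg 3) (Const 1))) (\<lambda>s'. bounded B s' \<and> regs s' 2 = int i
          \<and> ?I (Suc i) (s'\<lparr>regs := (regs s')(2 := int (Suc i))\<rparr>)) s'"
      proof (rule wp_Assign[OF bd], unfold val, intro conjI)
        show "bounded B ?t" using t by (rule ok_bounded)
        show "ok B (?t\<lparr>regs := (regs ?t)(2 := int (Suc i))\<rparr>)"
          using t Suc_i by (rule ok_regs_upd)
      qed (use I r2 in \<open>auto simp: same_regs_def\<close>)
    next
      assume "\<not> 0 < val (beats_expr sh) s'"
      then have eq: "rank sh j (Suc i) = rank sh j i" using pos by (simp add: rank_Suc)
      show "wp L B Skip (\<lambda>s'. bounded B s' \<and> regs s' 2 = int i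
          \<and> ?I (Suc i) (s'\<lparr>regs := (regs s')(2 := int (Suc i))\<rparr>)) s'"
        by (rule wp_Skip)
          (use I r2 Suc_i bd eq in \<open>auto simp: ok_def bounded_def same_regs_def simp del: of_nat_Suc\<close>)
    qed
  qed
qed

lemma cap_nonneg: "0 \<le> cap sh (bound d)"
  using l_nonneg u_ge_2 by (cases sh) (auto simp: bound_def)

lemma mem_chosen_iff:
  assumes "j < length js"
  shows "j \<in> chosen sh d \<longleftrightarrow> 0 < w sh j
    \<and> (j \<in> U sh \<longrightarrow> int (rank sh j (length js)) < cap sh (bound d))"
proof -
  have "{k \<in> {..<length js} \<inter> U sh. beats (w sh) k j}
      = {k. k < length js \<and> k \<in> U sh \<and> beats (w sh) k j}"
    by auto
  then show ?thesis
    using assms cap_nonneg[of sh d] by (auto simp: chosen_def greedy_def rank_def)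
qed

lemma wp_choose_prog:
  assumes s: "ok B s" "regs s 0 = int j" and j: "j < length js" and B: "L \<le> B"
  shows "wp L B (choose_prog sh d)
    (\<lambda>s'. ok B s' \<and> same_regs {2, 3, 4} s s' \<and> regs s' 4 = of_bool (j \<in> chosen sh d)) s"
  unfolding choose_prog_def
proof (intro wp_Seq wp_mono[OF wp_rank_prog[OF s j B]])
  fix s' assume *: "ok B s' \<and> same_regs {2, 3} s s' \<and> regs s' 3 = int (rank sh j (length js))"
  let ?Q = "\<lambda>s'. ok B s' \<and> same_regs {2, 3, 4} s s' \<and> regs s' 4 = of_bool (j \<in> chosen sh d)"
  have r0: "regs s' 0 = int j" using * s(2) by (simp add: same_regs_def)
  have M: "mem s' = M" and bd: "bounded B s'" using * by (simp_all add: ok_def)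
  have assign: "wp L B (Assign 4 (Const (of_bool (j \<in> chosen sh d)))) ?Q s'"
    using * bd bit_size_0_1 B
    by (intro wp_Assign) (auto simp: ok_def bounded_def same_regs_def)
  have capped_val: "val (Times (capped_expr sh 0) (Minus (Plus (Reg 3) (Const 1)) (cap_expr sh d))) s'
      = of_bool (j \<in> U sh) * (int (rank sh j (length js)) + 1 - cap sh (bound d))"
    using * by (simp add: val_capped_expr[OF M r0 j] val_cap_expr[OF M])
  show "wp L B (IfPos (weight_expr sh 0)
        (IfPos (Times (capped_expr sh 0) (Minus (Plus (Reg 3) (Const 1)) (cap_expr sh d)))
           (Assign 4 (Const 0)) (Assign 4 (Const 1)))
        (Assign 4 (Const 0))) ?Q s'"
  proof (intro wp_IfPos[OF bd], unfold weight_expr_pos_iff[OF M r0 j] capped_val)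
    assume "0 < w sh j" "0 < of_bool (j \<in> U sh) * (int (rank sh j (length js)) + 1 - cap sh (bound d))"
    then have "j \<notin> chosen sh d" by (cases "j \<in> U sh") (simp_all add: mem_chosen_iff[OF j])
    then show "wp L B (Assign 4 (Const 0)) ?Q s'" using assign by simp
  next
    assume "0 < w sh j" "\<not> 0 < of_bool (j \<in> U sh) * (int (rank sh j (length js)) + 1 - cap sh (bound d))"
    then have "j \<in> chosen sh d" by (cases "j \<in> U sh") (simp_all add: mem_chosen_iff[OF j])
    then show "wp L B (Assign 4 (Const 1)) ?Q s'" using assign by simp
  next
    assume "\<not> 0 < w sh j"
    then have "j \<notin> chosen sh d" by (auto simp: mem_chosen_iff[OF j])
    then show "wp L B (Assign 4 (Const 0)) ?Q s'" using assign by simp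
  qed
qed

text \<open>The objective after the first \<open>i\<close> elements. In a D-family the terms
  \<open>- z (js ! j)\<close> build up the missing negated sum over \<open>J\<close>, so that
  \<open>i = length js\<close> yields the excess.\<close>

definition partial_value :: "shape \<Rightarrow> bool \<Rightarrow> nat \<Rightarrow> rat" where
  "partial_value sh d i = const_term \<delta> sh (bound d) - (if d then 0 else of_int u)
     + (\<Sum>j<i. of_bool (j \<in> chosen sh d) * w sh j - of_bool d * z (js ! j))"

lemma val_init_expr:
  assumes "mem s = M"
  shows "of_int (val (init_expr sh d) s) = partial_value sh d 0 * of_int D"
  using assms
  by (simp add: init_expr_def sum4_def val_delta_prod val_bound_expr partial_value_def
      const_term_def sum_lessThan_4 bound_def algebra_simps)

text \<open>The bound is in terms of \<open>L\<close>, not of the larger \<open>B\<close> allowed by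
  \<open>ok\<close>. This makes the growth per iteration linear in \<open>L\<close> instead of
  compounding.\<close>

lemma bit_size_val_le:
  assumes "mem s = M" "\<And>r. r \<in> expr_regs e \<Longrightarrow> bit_size (regs s r) \<le> L"
  shows "bit_size (val e s) \<le> expr_factor e * L"
proof -
  have "bit_size (val e s) \<le> val_cost e s" by (rule bit_size_le_val_cost)
  also have "\<dots> \<le> expr_factor e * L"
    using assms bit_size_M by (intro val_cost_le_local) auto
  finally show ?thesis .
qed

lemma wp_eval_prog:
  assumes s: "ok B s" and B: "L \<le> B" "bit_bound sh d L \<le> B"
  shows "wp L B (eval_prog sh d)
    (\<lambda>s'. ok B s' \<and> same_regs {0, 2, 3, 4, 5, 6} s s' \<and> 0 < regs s' 6
      \<and> of_int (regs s' 5) = partial_value sh d (length js) * of_int (regs s' 6)) s"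
proof -
  let ?K = "growth sh d * L"
  \<comment> \<open>The size clauses must grow with \<open>i\<close>: each pass lengthens both
    registers, so the fixed bound in \<open>ok\<close> alone would not be inductive.\<close>
  let ?I = "\<lambda>i s'. ok B s' \<and> same_regs {0, 2, 3, 4, 5, 6} s s' \<and> 0 < regs s' 6
      \<and> of_int (regs s' 5) = partial_value sh d i * of_int (regs s' 6)
      \<and> bit_size (regs s' 5) \<le> ?K * (i + 1) \<and> bit_size (regs s' 6) \<le> ?K * (i + 1)"
  have small: "bit_size (int i) \<le> B" if "i \<le> length js" for i
    using bit_size_index[OF that] B by simp
  have fits: "x \<le> B" if "x \<le> ?K * (i + 1)" "i \<le> length js" for x i
  proof -
    have "?K * (i + 1) \<le> ?K * (L + 1)"
      using that(2) length_le_L by (intro mult_le_mono2) simp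
    then show ?thesis using that(1) B(2) unfolding bit_bound_def by (meson le_trans)
  qed
  have bit_init: "bit_size (val (init_expr sh d) s) \<le> ?K" "bit_size (val denom s) \<le> ?K"
    using bit_size_val_le[OF ok_mem[OF s], of "init_expr sh d"]
      bit_size_val_le[OF ok_mem[OF s], of denom]
    by (simp_all add: growth_def algebra_simps)
  let ?t = "s\<lparr>regs := (regs s)(5 := val (init_expr sh d) s)\<rparr>"
  let ?t' = "?t\<lparr>regs := (regs ?t)(6 := val denom ?t)\<rparr>"
  have t: "ok B ?t"
    using s bit_init(1) fits[of _ 0] by (intro ok_regs_upd) auto
  have D_t: "val denom ?t = D" "val denom s = D"
    using t s by (simp_all add: val_delta_prod(1) ok_def)
  have t': "ok B ?t'"
    by (rule ok_regs_upd[OF t]) (use bit_init(2) fits[of "bit_size D" 0] in \<open>simp add: D_t\<close>)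
  have loop: "wp L B (For 0 (Seq (choose_prog sh d)
       (Seq (Assign 5 (Plus (Times (Reg 5) scale_expr) (Times (term_expr sh d) (Reg 6))))
            (Assign 6 (Times (Reg 6) scale_expr))))) (?I (length js)) ?t'"
  proof (rule wp_For[where Inv = ?I and m = "length js"])
    show "bounded B ?t'" using t' by (rule ok_bounded)
    show "?I 0 (?t'\<lparr>regs := (regs ?t')(0 := 0)\<rparr>)"
      using t' small[of 0] bit_init D_pos val_init_expr[OF ok_mem[OF s], of sh d]
      by (auto simp: ok_def bounded_def same_regs_def D_t)
    show "length js \<le> L" by (rule length_le_L)
  next
    fix i s' assume "?I i s'"
    then show "bounded B s' \<and> mem s' 0 = int (length js)"
      by (simp add: ok_def M_header)
  next
    fix i s' assume i: "i < length js" and I: "?I i s'" and r0: "regs s' 0 = int i"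
    show "wp L B (Seq (choose_prog sh d)
       (Seq (Assign 5 (Plus (Times (Reg 5) scale_expr) (Times (term_expr sh d) (Reg 6))))
            (Assign 6 (Times (Reg 6) scale_expr))))
        (\<lambda>s'. bounded B s' \<and> regs s' 0 = int i
          \<and> ?I (Suc i) (s'\<lparr>regs := (regs s')(0 := int (Suc i))\<rparr>)) s'"
    proof (rule wp_Seq, rule wp_mono[OF wp_choose_prog[OF _ r0 i B(1)]])
      show "ok B s'" using I by simp
      fix s1 assume s1: "ok B s1 \<and> same_regs {2, 3, 4} s' s1 \<and> regs s1 4 = of_bool (i \<in> chosen sh d)"
      have M1: "mem s1 = M" using s1 by (simp add: ok_def)
      have regs1: "regs s1 0 = int i" "regs s1 5 = regs s' 5" "regs s1 6 = regs s' 6"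
        using s1 r0 by (simp_all add: same_regs_def)
      define c where "c = val scale_expr s1"
      define x where "x = val (term_expr sh d) s1"
      define v5 where "v5 = regs s' 5 * c + x * regs s' 6"
      define v6 where "v6 = regs s' 6 * c"
      have c: "c = b i * D"
        using val_entry_simps(4)[OF M1 regs1(1) i] val_delta_prod(1)[OF M1]
        by (simp add: c_def scale_expr_def)
      have x: "of_int x = (of_bool (i \<in> chosen sh d) * w sh i - of_bool d * z (js ! i)) * (of_int c :: rat)"
        using s1 val_weight_expr[OF M1 regs1(1) i, of sh] val_entry_simps(3)[OF M1 regs1(1) i]
          val_delta_prod(1)[OF M1]
        by (simp add: x_def term_expr_def c algebra_simps)
      have v5: "of_int v5 = partial_value sh d (Suc i) * (of_int v6 :: rat)"
      proof -
        define y where "y = of_bool (i \<in> chosen sh d) * w sh i - of_bool d * z (js ! i)"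
        have "partial_value sh d (Suc i) = partial_value sh d i + y"
          by (simp add: partial_value_def y_def)
        moreover have "of_int (regs s' 5) = partial_value sh d i * of_int (regs s' 6)"
          using I by blast
        ultimately show ?thesis
          using x unfolding y_def[symmetric] by (simp add: v5_def v6_def algebra_simps)
      qed
      have v6: "0 < v6"
        using I b_pos[of i] D_pos by (simp add: v6_def c)
      have i_L: "bit_size (int i) \<le> L" using i by (intro bit_size_index) simp
      have bit_c: "bit_size c \<le> expr_factor scale_expr * L"
        unfolding c_def using M1 by (rule bit_size_val_le) (use regs1 i_L in simp)
      have bit_x: "bit_size x \<le> expr_factor (term_expr sh d) * L"
        unfolding x_def using M1
        by (rule bit_size_val_le)
          (use s1 regs1 i_L bit_size_0_1 in \<open>auto simp: expr_regs_term_expr\<close>)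
      have L1: "1 \<le> L" using length_ge_2 length_le_L by simp
      \<comment> \<open>The summand 1 in \<open>growth\<close>, multiplied by \<open>L >= 1\<close>,
        pays for the carry bit of the addition.\<close>
      have factors: "expr_factor scale_expr * L + 1 \<le> ?K" "expr_factor (term_expr sh d) * L + 1 \<le> ?K"
        using L1 by (simp_all add: growth_def algebra_simps)
      have bit6: "bit_size v6 \<le> ?K * (Suc i + 1)"
        using bit_size_mult[of "regs s' 6" c] I bit_c factors(1) unfolding v6_def by simp
      have bit5: "bit_size v5 \<le> ?K * (Suc i + 1)"
      proof -
        have "bit_size (regs s' 5 * c) + 1 \<le> ?K * (Suc i + 1)"
          using bit_size_mult[of "regs s' 5" c] I bit_c factors(1) by simp
        moreover have "bit_size (x * regs s' 6) + 1 \<le> ?K * (Suc i + 1)"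
          using bit_size_mult[of x "regs s' 6"] I bit_x factors(2) by simp
        moreover have "bit_size v5 \<le> Suc (max (bit_size (regs s' 5 * c)) (bit_size (x * regs s' 6)))"
          unfolding v5_def by (rule bit_size_add)
        ultimately show ?thesis by linarith
      qed
      let ?s2 = "s1\<lparr>regs := (regs s1)(5 := v5)\<rparr>"
      let ?s3 = "?s2\<lparr>regs := (regs ?s2)(6 := v6)\<rparr>"
      have s2: "ok B ?s2" using s1 fits[OF bit5] i by (intro ok_regs_upd) auto
      have s3: "ok B ?s3" using fits[OF bit6] i by (intro ok_regs_upd s2) auto
      have val5: "val (Plus (Times (Reg 5) scale_expr) (Times (term_expr sh d) (Reg 6))) s1 = v5"
        by (simp add: v5_def c_def x_def regs1)
      have val6: "val (Times (Reg 6) scale_expr) ?s2 = v6"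
        by (simp add: v6_def c_def regs1 scale_expr_def entry_def denom_def delta_prod_def Let_def)
      show "wp L B (Seq (Assign 5 (Plus (Times (Reg 5) scale_expr) (Times (term_expr sh d) (Reg 6))))
            (Assign 6 (Times (Reg 6) scale_expr)))
        (\<lambda>s'. bounded B s' \<and> regs s' 0 = int i
          \<and> ?I (Suc i) (s'\<lparr>regs := (regs s')(0 := int (Suc i))\<rparr>)) s1"
      proof (intro wp_Seq wp_Assign, unfold val5, unfold val6)
        show "bounded B s1" using s1 by (simp add: ok_def)
        show "bounded B ?s2" using s2 by (rule ok_bounded)
        have "ok B (?s3\<lparr>regs := (regs ?s3)(0 := int (Suc i))\<rparr>)"
          using i by (intro ok_regs_upd s3 small) simp
        moreover have "same_regs {0, 2, 3, 4, 5, 6} s (?s3\<lparr>regs := (regs ?s3)(0 := int (Suc i))\<rparr>)"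
          using I s1 by (simp add: same_regs_def)
        ultimately show "bounded B ?s3 \<and> regs ?s3 0 = int i
            \<and> ?I (Suc i) (?s3\<lparr>regs := (regs ?s3)(0 := int (Suc i))\<rparr>)"
          using ok_bounded[OF s3] regs1 v5 v6 bit5 bit6 by simp
      qed
    qed
  qed
  show ?thesis
    unfolding eval_prog_def
    by (intro wp_Seq wp_Assign ok_bounded[OF s] ok_bounded[OF t] wp_mono[OF loop]) auto
qed

section \<open>Writing out the optimum\<close>

definition optimum :: "shape \<Rightarrow> bool \<Rightarrow> 'a set" where
  "optimum sh d = choice_set d ((!) js ` chosen sh d)"

lemma chosen_subset: "chosen sh d \<subseteq> {..<length js}"
  by (auto simp: chosen_def greedy_def)

lemma image_chosen_subset: "(!) js ` chosen sh d \<subseteq> J"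
  using chosen_subset[of sh d] set_js by auto

lemma inj_nth: "inj_on ((!) js) {..<length js}"
  using distinct_js by (auto simp: inj_on_def nth_eq_iff_index_eq)

lemma mem_image_iff:
  assumes "X \<subseteq> {..<length js}" "j < length js"
  shows "js ! j \<in> (!) js ` X \<longleftrightarrow> j \<in> X"
  using assms inj_nth by (auto simp: inj_on_def)

lemma wp_output_prog:
  assumes s: "ok B s" and B: "L \<le> B"
  shows "wp L B (output_prog sh d)
    (\<lambda>s'. out s' = out s @ encode_ineq js (ineq_of sh d (optimum sh d))) s"
proof -
  let ?x = "\<lambda>j. of_bool (js ! j \<in> optimum sh d) :: int"
  let ?I = "\<lambda>i s'. ok B s' \<and> out s' = out s @ header sh d @ map ?x [0..<i]"
  let ?s = "s\<lparr>out := out s @ header sh d\<rparr>"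
  have small: "bit_size (int i) \<le> B" if "i \<le> length js" for i
    using bit_size_index[OF that] B by simp
  have "wp L B (For 0 (Seq (choose_prog sh d) (Write (if d then Minus (Const 1) (Reg 4) else Reg 4))))
      (?I (length js)) ?s"
  proof (rule wp_For[where Inv = ?I and m = "length js"])
    show "bounded B ?s" using s by (simp add: ok_bounded)
    show "?I 0 (?s\<lparr>regs := (regs ?s)(0 := 0)\<rparr>)"
      using s small[of 0] ok_regs_upd[of B ?s 0 0] by simp
    show "length js \<le> L" by (rule length_le_L)
  next
    fix i s' assume "?I i s'"
    then show "bounded B s' \<and> mem s' 0 = int (length js)"
      by (simp add: ok_def M_header)
  next
    fix i s' assume i: "i < length js" and I: "?I i s'" and r0: "regs s' 0 = int i"
    show "wp L B (Seq (choose_prog sh d) (Write (if d then Minus (Const 1) (Reg 4) else Reg 4)))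
        (\<lambda>s'. bounded B s' \<and> regs s' 0 = int i
          \<and> ?I (Suc i) (s'\<lparr>regs := (regs s')(0 := int (Suc i))\<rparr>)) s'"
    proof (rule wp_Seq, rule wp_mono[OF wp_choose_prog[OF _ r0 i B]])
      show "ok B s'" using I by simp
      fix s1 assume s1: "ok B s1 \<and> same_regs {2, 3, 4} s' s1 \<and> regs s1 4 = of_bool (i \<in> chosen sh d)"
      have iJ: "js ! i \<in> J" using i set_js by auto
      have val: "val (if d then Minus (Const 1) (Reg 4) else Reg 4) s1 = ?x i"
        using s1 iJ by (simp add: optimum_def choice_set_def mem_image_iff[OF chosen_subset i])
      let ?s2 = "s1\<lparr>out := out s1 @ [?x i]\<rparr>"
      have "ok B (?s2\<lparr>regs := (regs ?s2)(0 := int (Suc i))\<rparr>)"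
        using s1 i by (intro ok_regs_upd small) simp_all
      then show "wp L B (Write (if d then Minus (Const 1) (Reg 4) else Reg 4))
        (\<lambda>s'. bounded B s' \<and> regs s' 0 = int i
          \<and> ?I (Suc i) (s'\<lparr>regs := (regs s')(0 := int (Suc i))\<rparr>)) s1"
        using s1 I r0 by (intro wp_Write) (simp_all add: val ok_bounded same_regs_def)
    qed
  qed
  moreover have "map ?x [0..<length js] = encode_set js (optimum sh d)"
    by (rule nth_equalityI) (simp_all add: encode_set_def)
  ultimately show ?thesis
    unfolding output_prog_def
    by (intro wp_Seq wp_write_list ok_bounded[OF s]) (auto simp: encode_ineq_of elim!: wp_mono)
qed

end

section \<open>Most violated inequalities\<close>

context problem
begin

lemma sum_index: "X \<subseteq> {..<length js} \<Longrightarrow> (\<Sum>j\<in>X. f (js ! j)) = sum f ((!) js ` X)"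
  by (subst sum.reindex) (auto intro: inj_on_subset[OF inj_nth])

lemma image_nth: "(!) js ` {..<length js} = J"
  using set_js by (auto simp: in_set_conv_nth)

lemma choice_set_choice_set: "Q \<subseteq> J \<Longrightarrow> choice_set d (choice_set d Q) = Q"
  by (auto simp: choice_set_def)

lemma optimum_subset: "optimum sh d \<subseteq> J"
  using image_chosen_subset by (auto simp: optimum_def choice_set_def)

definition excess :: "'a ineq \<Rightarrow> rat" where
  "excess q = lhs \<delta> z q - rhs q"

lemma excess_ineq_of:
  assumes "sh \<in> shapes" "X \<subseteq> {..<length js}" "choice_set d Q = (!) js ` X" "Q \<subseteq> J"
  shows "excess (ineq_of sh d Q) = const_term \<delta> sh (bound d) + sum (w sh) X
      - (if d then (\<Sum>j\<in>J. z j) else of_int u)"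
  unfolding excess_def lhs_ineq_of[OF assms(1,4)] assms(3) sum_index[OF assms(2), symmetric]
  by (simp add: w_def)

lemma admissible_ineq_of_index:
  assumes "sh \<in> shapes" "X \<subseteq> {..<length js}" "choice_set d Q = (!) js ` X" "Q \<subseteq> J"
  shows "admissible (ineq_of sh d Q) \<longleftrightarrow> card (X \<inter> U sh) \<le> nat (cap sh (bound d))"
proof -
  have "{j \<in> choice_set d Q. capped sh (j \<in> S1) (j \<in> S2)} = (!) js ` (X \<inter> U sh)"
    unfolding assms(3) by (auto simp: U_def)
  then have "card {j \<in> choice_set d Q. capped sh (j \<in> S1) (j \<in> S2)} = card (X \<inter> U sh)"
    using assms(2) inj_on_subset[OF inj_nth] by (metis card_image le_infI1)
  then show ?thesis
    using admissible_ineq_of[OF assms(1), of d Q] assms(4) cap_nonneg[of sh d] by auto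
qed

lemma choice_set_optimum: "choice_set d (optimum sh d) = (!) js ` chosen sh d"
  unfolding optimum_def by (rule choice_set_choice_set[OF image_chosen_subset])

lemma admissible_optimum:
  assumes "sh \<in> shapes"
  shows "admissible (ineq_of sh d (optimum sh d))"
  using admissible_ineq_of_index[OF assms chosen_subset choice_set_optimum optimum_subset, of d]
    card_greedy_Int_le[OF finite_lessThan] unfolding chosen_def by blast

lemma excess_optimum:
  assumes "sh \<in> shapes"
  shows "excess (ineq_of sh d (optimum sh d)) = const_term \<delta> sh (bound d)
      + sum (w sh) (chosen sh d) - (if d then (\<Sum>j\<in>J. z j) else of_int u)"
  by (rule excess_ineq_of[OF assms chosen_subset choice_set_optimum optimum_subset])

text \<open>The constants depend only on shape and flag, so the excesses compare as the weight sums
  do. Pulling \<open>Q\<close> back to list positions makes this the optimality of the greedy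
  set.\<close>

lemma excess_le_optimum:
  assumes "sh \<in> shapes" "admissible (ineq_of sh d Q)"
  shows "excess (ineq_of sh d Q) \<le> excess (ineq_of sh d (optimum sh d))"
proof -
  have Q: "Q \<subseteq> J" using assms by (simp add: admissible_ineq_of)
  define X where "X = {j. j < length js \<and> js ! j \<in> choice_set d Q}"
  have X: "X \<subseteq> {..<length js}" by (auto simp: X_def)
  have "choice_set d Q \<subseteq> (!) js ` {..<length js}"
    using Q unfolding image_nth by (auto simp: choice_set_def)
  then have QX: "choice_set d Q = (!) js ` X"
    by (auto simp: X_def)
  have "card (X \<inter> U sh) \<le> nat (cap sh (bound d))"
    using assms(2) admissible_ineq_of_index[OF assms(1) X QX Q] by blast
  then have "sum (w sh) X \<le> sum (w sh) (chosen sh d)"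
    unfolding chosen_def by (rule sum_le_sum_greedy[OF finite_lessThan X])
  then show ?thesis
    using excess_ineq_of[OF assms(1) X QX Q]
      excess_optimum[OF assms(1), of d] by simp
qed

lemma partial_value_optimum:
  assumes "sh \<in> shapes"
  shows "partial_value sh d (length js) = excess (ineq_of sh d (optimum sh d))"
proof -
  have "(\<Sum>j<length js. of_bool (j \<in> chosen sh d) * w sh j) = sum (w sh) (chosen sh d)"
  proof -
    have "(\<Sum>j<length js. of_bool (j \<in> chosen sh d) * w sh j)
        = (\<Sum>j<length js. if j \<in> chosen sh d then w sh j else 0)"
      by (rule sum.cong) auto
    also have "\<dots> = sum (w sh) ({..<length js} \<inter> chosen sh d)"
      by (rule sum.inter_restrict[symmetric]) simp
    finally show ?thesis using Int_absorb1[OF chosen_subset] by simp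
  qed
  moreover have "(\<Sum>j<length js. z (js ! j)) = (\<Sum>j\<in>J. z j)"
    using sum_index[OF subset_refl, of z] unfolding image_nth .
  ultimately have "partial_value sh d (length js) = const_term \<delta> sh (bound d)
      + sum (w sh) (chosen sh d) - (if d then (\<Sum>j\<in>J. z j) else of_int u)"
    unfolding partial_value_def sum_subtractf by (cases d) simp_all
  then show ?thesis
    using excess_optimum[OF assms, of d] by simp
qed

lemma ok_init_state:
  assumes "L \<le> B"
  shows "ok B (init_state input_list)"
proof -
  have "bit_size (regs (init_state input_list) r) \<le> B" for r
    using bit_size_0_1(1) assms by (simp add: init_state_def)
  moreover have "bit_size (mem (init_state input_list) a) \<le> B" for a
    using bit_size_M[of a] assms unfolding M_def by (rule le_trans)
  ultimately show ?thesis by (simp add: ok_def bounded_def M_def)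
qed

end

section \<open>Programs for a single family and for separation\<close>

lemma out_init_state: "out (init_state xs) = []"
  by (simp add: init_state_def)

text \<open>A family has at most two shapes; a family with one shape passes it twice. The two values
  are fractions with positive denominators, compared by cross-multiplication. The winning set is
  recomputed on output, as no set is ever stored.\<close>

definition better_prog :: "bool \<Rightarrow> shape \<Rightarrow> shape \<Rightarrow> prog" where
  "better_prog d sh1 sh2 =
     Seq (eval_prog sh1 d) (Seq (Assign 7 (Reg 5)) (Seq (Assign 8 (Reg 6)) (Seq (eval_prog sh2 d)
       (IfPos (Minus (Times (Reg 5) (Reg 8)) (Times (Reg 7) (Reg 6)))
          (output_prog sh2 d) (output_prog sh1 d)))))"

text \<open>The denominator in register 6 is positive, so the sign of register 5 alone decides
  whether the optimum of a shape is violated.\<close>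

fun separate_prog :: "(shape \<times> bool) list \<Rightarrow> prog" where
  "separate_prog [] = Write (Const 0)"
| "separate_prog ((sh, d) # vs) =
     Seq (eval_prog sh d) (IfPos (Reg 5) (output_prog sh d) (separate_prog vs))"

context problem
begin

lemma wp_better_prog:
  assumes sh: "sh1 \<in> shapes" "sh2 \<in> shapes" and s: "ok B s" "out s = []"
    and B: "L \<le> B" "bit_bound sh1 d L \<le> B" "bit_bound sh2 d L \<le> B"
  shows "wp L B (better_prog d sh1 sh2) (\<lambda>s'. \<exists>sh\<in>{sh1, sh2}.
    out s' = encode_ineq js (ineq_of sh d (optimum sh d)) \<and>
    (\<forall>sh'\<in>{sh1, sh2}. excess (ineq_of sh' d (optimum sh' d)) \<le> excess (ineq_of sh d (optimum sh d)))) s"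
  (is "wp L B _ ?Q s")
  unfolding better_prog_def
proof (rule wp_Seq, rule wp_mono[OF wp_eval_prog[OF s(1) B(1,2)]])
  let ?v = "\<lambda>sh. excess (ineq_of sh d (optimum sh d))"
  fix s1 assume s1: "ok B s1 \<and> same_regs {0, 2, 3, 4, 5, 6} s s1 \<and> 0 < regs s1 6
      \<and> of_int (regs s1 5) = partial_value sh1 d (length js) * of_int (regs s1 6)"
  let ?s2 = "s1\<lparr>regs := (regs s1)(7 := regs s1 5)\<rparr>"
  let ?s3 = "?s2\<lparr>regs := (regs ?s2)(8 := regs s1 6)\<rparr>"
  have ok: "ok B ?s2" "ok B ?s3" using s1 by (auto simp: ok_def bounded_def)
  have "wp L B (Seq (eval_prog sh2 d)
      (IfPos (Minus (Times (Reg 5) (Reg 8)) (Times (Reg 7) (Reg 6)))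
        (output_prog sh2 d) (output_prog sh1 d))) ?Q ?s3"
  proof (rule wp_Seq, rule wp_mono[OF wp_eval_prog[OF ok(2) B(1,3)]])
    fix s4 assume s4: "ok B s4 \<and> same_regs {0, 2, 3, 4, 5, 6} ?s3 s4 \<and> 0 < regs s4 6
      \<and> of_int (regs s4 5) = partial_value sh2 d (length js) * of_int (regs s4 6)"
    have regs4: "regs s4 7 = regs s1 5" "regs s4 8 = regs s1 6" "out s4 = []"
      using s1 s4 s(2) by (simp_all add: same_regs_def)
    let ?e = "Minus (Times (Reg 5) (Reg 8)) (Times (Reg 7) (Reg 6))"
    have "of_int (val ?e s4) = (?v sh2 - ?v sh1) * (of_int (regs s4 6) * of_int (regs s1 6) :: rat)"
      using s1 s4 by (simp add: regs4 partial_value_optimum sh algebra_simps)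
    moreover have "0 < (of_int (regs s4 6) * of_int (regs s1 6) :: rat)"
      using s1 s4 by simp
    ultimately have "0 < (of_int (val ?e s4) :: rat) \<longleftrightarrow> ?v sh1 < ?v sh2"
      by (metis diff_gt_0_iff_gt mult_pos_pos zero_less_mult_pos2)
    then have cmp: "0 < val ?e s4 \<longleftrightarrow> ?v sh1 < ?v sh2" by (simp only: of_int_0_less_iff)
    have ok4: "ok B s4" using s4 by blast
    show "wp L B (IfPos ?e (output_prog sh2 d) (output_prog sh1 d)) ?Q s4"
    proof (rule wp_IfPos[OF ok_bounded[OF ok4]], unfold cmp)
      assume "?v sh1 < ?v sh2"
      then show "wp L B (output_prog sh2 d) ?Q s4"
        by (intro wp_mono[OF wp_output_prog[OF ok4 B(1)]]) (auto simp: regs4)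
    next
      assume "\<not> ?v sh1 < ?v sh2"
      then show "wp L B (output_prog sh1 d) ?Q s4"
        by (intro wp_mono[OF wp_output_prog[OF ok4 B(1)]]) (auto simp: regs4)
    qed
  qed
  then show "wp L B (Seq (Assign 7 (Reg 5)) (Seq (Assign 8 (Reg 6)) (Seq (eval_prog sh2 d)
      (IfPos (Minus (Times (Reg 5) (Reg 8)) (Times (Reg 7) (Reg 6)))
        (output_prog sh2 d) (output_prog sh1 d))))) ?Q s1"
    by - (rule wp_Seq, rule wp_Assign, use s1 in \<open>simp add: ok_def\<close>, rule wp_Seq, rule wp_Assign,
        use ok in \<open>simp_all add: ok_def\<close>)
qed

lemma wp_separate_prog:
  assumes "\<And>sh d. (sh, d) \<in> set vs \<Longrightarrow> sh \<in> shapes \<and> bit_bound sh d L \<le> B"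
    and "ok B s" "out s = []" and B: "L \<le> B"
  shows "wp L B (separate_prog vs) (\<lambda>s'.
    if \<exists>(sh, d)\<in>set vs. 0 < excess (ineq_of sh d (optimum sh d))
    then \<exists>(sh, d)\<in>set vs. 0 < excess (ineq_of sh d (optimum sh d))
      \<and> out s' = encode_ineq js (ineq_of sh d (optimum sh d))
    else out s' = [0]) s"
  using assms(1-3)
proof (induction vs arbitrary: s)
  case Nil
  then show ?case by (auto intro!: wp_Write ok_bounded)
next
  case (Cons v vs)
  obtain sh d where v: "v = (sh, d)" by (cases v)
  let ?v = "excess (ineq_of sh d (optimum sh d))"
  let ?Q = "\<lambda>vs s'. if \<exists>(sh, d)\<in>set vs. 0 < excess (ineq_of sh d (optimum sh d))
    then \<exists>(sh, d)\<in>set vs. 0 < excess (ineq_of sh d (optimum sh d))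
      \<and> out s' = encode_ineq js (ineq_of sh d (optimum sh d))
    else out s' = [0]"
  have sh: "sh \<in> shapes" "bit_bound sh d L \<le> B" using Cons.prems(1) v by auto
  have "wp L B (separate_prog ((sh, d) # vs)) (?Q ((sh, d) # vs)) s"
    unfolding separate_prog.simps
  proof (rule wp_Seq, rule wp_mono[OF wp_eval_prog[OF Cons.prems(2) B sh(2)]])
    fix s1 assume s1: "ok B s1 \<and> same_regs {0, 2, 3, 4, 5, 6} s s1 \<and> 0 < regs s1 6
      \<and> of_int (regs s1 5) = partial_value sh d (length js) * of_int (regs s1 6)"
    then have ok1: "ok B s1" and out1: "out s1 = []"
      using Cons.prems(3) by (simp_all add: same_regs_def)
    have "0 < (of_int (regs s1 5) :: rat) \<longleftrightarrow> 0 < ?v"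
      using s1 partial_value_optimum[OF sh(1), of d]
      by (metis mult_pos_pos of_int_0_less_iff zero_less_mult_pos2)
    then have pos: "0 < val (Reg 5) s1 \<longleftrightarrow> 0 < ?v" by simp
    show "wp L B (IfPos (Reg 5) (output_prog sh d) (separate_prog vs)) (?Q ((sh, d) # vs)) s1"
    proof (rule wp_IfPos[OF ok_bounded[OF ok1]], unfold pos)
      assume "0 < ?v"
      then show "wp L B (output_prog sh d) (?Q ((sh, d) # vs)) s1"
        by (intro wp_mono[OF wp_output_prog[OF ok1 B]]) (auto simp: out1)
    next
      assume not_pos: "\<not> 0 < ?v"
      have "wp L B (separate_prog vs) (?Q vs) s1"
        using Cons.prems(1) by (intro Cons.IH ok1 out1) auto
      then show "wp L B (separate_prog vs) (?Q ((sh, d) # vs)) s1"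
        by (rule wp_mono) (use not_pos in auto)
    qed
  qed
  then show ?case unfolding v .
qed

end

section \<open>From shapes back to families, and the polynomial bounds\<close>

definition family_shapes :: "nat \<Rightarrow> shape \<times> shape" where
  "family_shapes f = (let m = if 5 < f then f - 5 else f in
     if m = 1 then (Shape1, Shape1) else if m = 2 then (Shape2, Shape2)
     else if m = 3 then (Shape3 1 2, Shape3 2 1) else if m = 4 then (Shape4 1, Shape4 2)
     else (Shape5, Shape5))"

lemma family_ineq_of_iff:
  assumes "f \<in> {1..10}" "family_shapes f = (sh1, sh2)" "sh \<in> shapes"
  shows "family (ineq_of sh d Q) = f \<longleftrightarrow> sh \<in> {sh1, sh2} \<and> d = (5 < f)"
proof -
  define m where "m = (if 5 < f then f - 5 else f)"
  have m: "1 \<le> m" "m \<le> 5" using assms(1) by (auto simp: m_def)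
  define i where "i = family (ineq_of sh False Q)"
  have "i \<le> 5" and fam: "family (ineq_of sh d Q) = i + (if d then 5 else 0)" and "1 \<le> i"
    by (cases sh; simp add: i_def)+
  then have "family (ineq_of sh d Q) = f \<longleftrightarrow> i = m \<and> d = (5 < f)"
    using assms(1) unfolding m_def by (cases d) auto
  moreover have "i = m \<longleftrightarrow> sh \<in> {sh1, sh2}"
    using assms(2,3) m unfolding family_shapes_def Let_def m_def[symmetric] shapes_def i_def
    by (elim insertE emptyE) (auto split: if_splits)
  ultimately show ?thesis by blast
qed

lemma family_shapes_in_shapes: "family_shapes f = (sh1, sh2) \<Longrightarrow> sh1 \<in> shapes \<and> sh2 \<in> shapes"
  by (auto simp: family_shapes_def shapes_def Let_def split: if_splits)

text \<open>Loop counts are bounded by \<open>L\<close> and sizes by \<open>poly q L\<close>, so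
  \<open>prog_cost_poly\<close> supplies the time bound; \<open>c\<close> and \<open>q\<close> are
  fixed before the instance.\<close>

lemma poly_time_solvableI:
  assumes "\<And>J S1 S2 l u js \<delta> z. (J, S1, S2, l, u, js, \<delta>, z) \<in> X \<Longrightarrow> problem J S1 S2 l u js"
    and "\<And>J S1 S2 l u js \<delta> z s. (J, S1, S2, l, u, js, \<delta>, z) \<in> X \<Longrightarrow> problem J S1 S2 l u js \<Longrightarrow>
      wp (problem.L J S1 S2 l u js \<delta> z) (poly q (problem.L J S1 S2 l u js \<delta> z)) c
        (\<lambda>s'. R (J, S1, S2, l, u, js, \<delta>, z) (out s'))
        (init_state (problem.input_list J S1 S2 l u js \<delta> z))"
  shows "poly_time_solvable X encode_input R"
proof -
  obtain p where p: "\<And>x. prog_cost c x (poly q x) = poly p x"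
    using prog_cost_poly[of c q] by blast
  show ?thesis
    unfolding poly_time_solvable_def
  proof (intro exI[of _ c] exI[of _ p] ballI)
    fix x assume x: "x \<in> X"
    obtain J S1 S2 l u js \<delta> z where eq: "x = (J, S1, S2, l, u, js, \<delta>, z)"
      by (metis surj_pair)
    interpret problem J S1 S2 l u js \<delta> z using assms(1) x eq by blast
    show "\<exists>t s'. exec c (init_state (encode_input x)) t s'
        \<and> t \<le> poly p (input_size (encode_input x)) \<and> R x (out s')"
      using assms(2)[of J S1 S2 l u js \<delta> z] x problem_axioms
      unfolding eq wp_def p L_def input_list_def by blast
  qed
qed

lemma problem_if_inputs: "(J, S1, S2, l, u, js, \<delta>, z) \<in> inputs \<Longrightarrow> problem J S1 S2 l u js"
  unfolding inputs_def by (auto intro!: problem.intro simp: problem_axioms_def)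

lemma problem_if_inputs_AB: "(J, S1, S2, l, u, js, \<delta>, z) \<in> inputs_AB \<Longrightarrow> problem J S1 S2 l u js"
  unfolding inputs_AB_def by (auto intro: problem_if_inputs)

text \<open>The quadratic form is that of \<open>bit_bound\<close>; \<open>Suc K\<close> in place of
  \<open>K\<close> keeps the polynomial above \<open>x\<close> for every \<open>K\<close>.\<close>

definition bound_poly :: "nat \<Rightarrow> nat poly" where
  "bound_poly K = smult (Suc K) ([:0, 1:] * [:1, 1:])"

lemma le_poly_bound_poly: "x \<le> poly (bound_poly K) x"
  by (simp add: bound_poly_def)

lemma bit_bound_le_poly_bound_poly:
  assumes "growth sh d \<le> K"
  shows "bit_bound sh d x \<le> poly (bound_poly K) x"
proof -
  have "growth sh d * (x * (x + 1)) \<le> Suc K * (x * (x + 1))"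
    using assms by (intro mult_le_mono1) simp
  then show ?thesis by (simp add: bound_poly_def bit_bound_def algebra_simps)
qed

lemma poly_time_most_violated:
  assumes f: "f \<in> {1..10}"
  shows "poly_time_solvable inputs_AB encode_input (outputs_most_violated f)"
proof -
  obtain sh1 sh2 where fs: "family_shapes f = (sh1, sh2)" by (cases "family_shapes f")
  have sh: "sh1 \<in> shapes" "sh2 \<in> shapes" using family_shapes_in_shapes[OF fs] by simp_all
  define d where "d = (5 < f)"
  define K where "K = growth sh1 d + growth sh2 d"
  show ?thesis
  proof (rule poly_time_solvableI[where c = "better_prog d sh1 sh2" and q = "bound_poly K"])
    fix J S1 S2 l u js \<delta> z
    assume "(J, S1, S2, l, u, js, \<delta>, z) \<in> inputs_AB"
    then show "problem J S1 S2 l u js" by (rule problem_if_inputs_AB)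
  next
    fix J S1 S2 :: "'a set" and l u js \<delta> z
    assume "problem J S1 S2 l u js"
    then interpret problem J S1 S2 l u js \<delta> z .
    show "wp L (poly (bound_poly K) L) (better_prog d sh1 sh2)
        (\<lambda>s'. outputs_most_violated f (J, S1, S2, l, u, js, \<delta>, z) (out s')) (init_state input_list)"
    proof (rule wp_mono[OF wp_better_prog[OF sh]])
      fix s' assume "\<exists>sh\<in>{sh1, sh2}. out s' = encode_ineq js (ineq_of sh d (optimum sh d)) \<and>
        (\<forall>sh'\<in>{sh1, sh2}. excess (ineq_of sh' d (optimum sh' d)) \<le> excess (ineq_of sh d (optimum sh d)))"
      then obtain sh where *: "sh \<in> {sh1, sh2}" "out s' = encode_ineq js (ineq_of sh d (optimum sh d))"
        "\<And>sh'. sh' \<in> {sh1, sh2} \<Longrightarrow>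
          excess (ineq_of sh' d (optimum sh' d)) \<le> excess (ineq_of sh d (optimum sh d))" by blast
      have "sh \<in> shapes" using * sh by auto
      have "most_violated f \<delta> z (ineq_of sh d (optimum sh d))"
        unfolding most_violated_def is_arg_max_linorder
      proof (intro conjI allI impI)
        show "admissible (ineq_of sh d (optimum sh d))"
          using \<open>sh \<in> shapes\<close> by (rule admissible_optimum)
        show "family (ineq_of sh d (optimum sh d)) = f"
          unfolding family_ineq_of_iff[OF f fs \<open>sh \<in> shapes\<close>] using *(1) by (simp add: d_def)
        fix q assume q: "admissible q \<and> family q = f"
        then obtain sh' d' Q where q': "sh' \<in> shapes" "Q \<subseteq> J" "q = ineq_of sh' d' Q"
          using admissible_cases by blast
        then have "sh' \<in> {sh1, sh2}" "d' = d"
          using q family_ineq_of_iff[OF f fs q'(1), of d' Q] by (simp_all add: d_def)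
        \<comment> \<open>Two comparisons are chained: \<open>q\<close> with the optimum of its own
          shape, and that optimum with the winner.\<close>
        then have "excess q \<le> excess (ineq_of sh d (optimum sh d))"
          using excess_le_optimum[OF q'(1), of d Q] q q'(3) *(3)[of sh'] by simp
        then show "lhs \<delta> z q - rhs q
            \<le> lhs \<delta> z (ineq_of sh d (optimum sh d)) - rhs (ineq_of sh d (optimum sh d))"
          by (simp add: excess_def)
      qed
      then show "outputs_most_violated f (J, S1, S2, l, u, js, \<delta>, z) (out s')"
        using *(2) by auto
    qed (auto intro!: ok_init_state le_poly_bound_poly bit_bound_le_poly_bound_poly
        simp: out_init_state K_def)
  qed
qed

text \<open>Some admissible inequality is violated iff the optimum of some shape and flag has
  positive excess, so finitely many sign tests decide the problem.\<close>

lemma poly_time_separation: "poly_time_solvable inputs encode_input separates"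
proof -
  obtain shs where shs: "set shs = shapes"
    using finite_list[of shapes] by (auto simp: shapes_def)
  define vs where "vs = List.product shs [False, True]"
  have vs: "(sh, d) \<in> set vs \<longleftrightarrow> sh \<in> shapes" for sh d
    by (auto simp: vs_def shs)
  define K where "K = (\<Sum>(sh, d)\<in>set vs. growth sh d)"
  have K: "growth sh d \<le> K" if "sh \<in> shapes" for sh d
    unfolding K_def using member_le_sum[of "(sh, d)" "set vs" "\<lambda>(sh, d). growth sh d"] vs that by simp
  show ?thesis
  proof (rule poly_time_solvableI[where c = "separate_prog vs" and q = "bound_poly K"])
    fix J S1 S2 l u js \<delta> z
    assume "(J, S1, S2, l, u, js, \<delta>, z) \<in> inputs"
    then show "problem J S1 S2 l u js" by (rule problem_if_inputs)
  next
    fix J S1 S2 :: "'a set" and l u js \<delta> z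
    assume "problem J S1 S2 l u js"
    then interpret problem J S1 S2 l u js \<delta> z .
    let ?P = "\<exists>(sh, d)\<in>set vs. 0 < excess (ineq_of sh d (optimum sh d))"
    have violated: "\<not> satisfies \<delta> z q \<longleftrightarrow> 0 < excess q" for q
      by (auto simp: satisfies_def excess_def)
    have P: "?P \<longleftrightarrow> \<not> (\<forall>q. admissible q \<longrightarrow> satisfies \<delta> z q)"
    proof
      assume ?P
      then show "\<not> (\<forall>q. admissible q \<longrightarrow> satisfies \<delta> z q)"
        using admissible_optimum violated vs by blast
    next
      assume "\<not> (\<forall>q. admissible q \<longrightarrow> satisfies \<delta> z q)"
      then obtain q where q: "admissible q" "0 < excess q" using violated by blast
      then obtain sh d Q where "sh \<in> shapes" "q = ineq_of sh d Q" using admissible_cases by blast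
      moreover from this have "0 < excess (ineq_of sh d (optimum sh d))"
        using q excess_le_optimum[of sh d Q] by simp
      ultimately show ?P
        using vs by (intro bexI[of _ "(sh, d)"]) simp_all
    qed
    show "wp L (poly (bound_poly K) L) (separate_prog vs)
        (\<lambda>s'. separates (J, S1, S2, l, u, js, \<delta>, z) (out s')) (init_state input_list)"
    proof (rule wp_mono[OF wp_separate_prog[of vs]])
      fix s' assume *: "if ?P then \<exists>(sh, d)\<in>set vs. 0 < excess (ineq_of sh d (optimum sh d))
          \<and> out s' = encode_ineq js (ineq_of sh d (optimum sh d)) else out s' = [0]"
      show "separates (J, S1, S2, l, u, js, \<delta>, z) (out s')"
      proof (cases ?P)
        case True
        then obtain sh d where "sh \<in> shapes" "0 < excess (ineq_of sh d (optimum sh d))"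
          "out s' = encode_ineq js (ineq_of sh d (optimum sh d))"
          using * vs by auto
        then have "\<exists>q. admissible q \<and> \<not> satisfies \<delta> z q \<and> out s' = encode_ineq js q"
          using admissible_optimum violated by blast
        then show ?thesis using True unfolding P by auto
      next
        case False
        then show ?thesis using * P by auto
      qed
    next
      fix sh d assume "(sh, d) \<in> set vs"
      then show "sh \<in> shapes \<and> bit_bound sh d L \<le> poly (bound_poly K) L"
        using K vs by (auto intro: bit_bound_le_poly_bound_poly)
    qed (auto intro!: ok_init_state le_poly_bound_poly simp: out_init_state)
  qed
qed

theorem mainTheorem3:
  shows "(\<forall>f\<in>{1..10}. poly_time_solvable (inputs_AB :: 'a input set) encode_input
            (outputs_most_violated f))
       \<and> poly_time_solvable (inputs :: 'a input set) encode_input separates"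
  using poly_time_most_violated poly_time_separation by blast

end
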